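(* Let $X=Y\oplus Z$ be a separable reflexive Banach space, where $Y,Z$ are closed linear subspaces, and let $G\leqslant \mathrm{GL}(X)$ be a bounded subgroup leaving $Y$ invariant. Assume that there are no closed linear $G$-invariant subspaces $W$ with $\{0\}\subsetneq W\subsetneq Y$, no closed linear $G$-invariant subspaces $W$ with $Y\subsetneq W\subsetneq X$, and that there is no closed linear $G$-invariant complement of $Y$ in $X$. Write the elements of $G$ as block matrices $\begin{pmatrix} u & w\\ 0 & v\end{pmatrix}$ with respect to the decomposition $X=Y\oplus Z$. Then the mappings $$\begin{pmatrix} u & w \\ 0 & v \end{pmatrix}\mapsto u\qquad\text{and}\qquad \begin{pmatrix} u & w \\ 0 & v \end{pmatrix}\mapsto v$$ are isomorphisms of topological groups, for the strong operator topologies, between $G$ and the respective images in $\mathrm{GL}(Y)$ and $\mathrm{GL}(Z)$.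
   Context: $\mathrm{GL}(X)$ is the group of all continuous linear automorphisms of a Banach space $X$. A subgroup $G\leqslant \mathrm{GL}(X)$ is bounded if $\sup_{T\in G}\|T\|<\infty$. A subspace $W$ is $G$-invariant if $T[W]\subseteq W$ for all $T\in G$. Since $Y$ is $G$-invariant, each $T\in G$ has a block upper triangular form with $u=T|_Y\in \mathrm{GL}(Y)$, $v\in\mathrm{GL}(Z)$ and $w\colon Z\to Y$ bounded linear. *)

theory Defs
  imports "HOL-Analysis.Analysis" "HOL-Algebra.Bij"
begin

text \<open>
  The ambient Banach space is a type of class \<open>banach\<close> with a scalar multiplication over
  a field \<open>'k\<close>. The sort \<open>{real_normed_field, euclidean_space}\<close> has the instances \<open>real\<close> and
  \<open>complex\<close> and, up to isomorphism, no other ones, so real and complex Banach spaces are treated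
  simultaneously. Subspaces and operators are linear over \<open>'k\<close>.
\<close>

locale banach_over = vector_space scl
  for scl :: "'k::{real_normed_field,euclidean_space} \<Rightarrow> 'a::banach \<Rightarrow> 'a" +
  assumes scale_of_real: "scl (of_real r) x = r *\<^sub>R x"
    and norm_scale: "norm (scl c x) = norm c * norm x"

lemma banach_over_real: "banach_over (scaleR :: real \<Rightarrow> 'a::banach \<Rightarrow> 'a)"
  by unfold_locales (auto simp: algebra_simps)

lemma banach_over_complex: "banach_over ((*) :: complex \<Rightarrow> complex \<Rightarrow> complex)"
  by unfold_locales (auto simp: algebra_simps norm_mult scaleR_conv_of_real)

definition closed_subspace :: "('k::comm_ring_1 \<Rightarrow> 'a::real_normed_vector \<Rightarrow> 'a) \<Rightarrow> 'a set \<Rightarrow> bool"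
  where "closed_subspace scl W \<longleftrightarrow> module.subspace scl W \<and> closed W"

definition complementary :: "'a::ab_group_add set \<Rightarrow> 'a set \<Rightarrow> bool"
  where "complementary Y Z \<longleftrightarrow> Y \<inter> Z = {0} \<and> {y + z | y z. y \<in> Y \<and> z \<in> Z} = UNIV"

definition dual_space ::
    "('k::{real_normed_field,euclidean_space} \<Rightarrow> 'a::banach \<Rightarrow> 'a) \<Rightarrow> ('a \<Rightarrow> 'k) set"
  where "dual_space scl = {f. Vector_Spaces.linear scl (*) f \<and> bounded_linear f}"

text \<open>Only the values of a bidual functional on \<open>dual_space scl\<close> are relevant.\<close>

definition bidual_space ::
    "('k::{real_normed_field,euclidean_space} \<Rightarrow> 'a::banach \<Rightarrow> 'a) \<Rightarrow> (('a \<Rightarrow> 'k) \<Rightarrow> 'k) set"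
  where "bidual_space scl = {F.
    (\<forall>f\<in>dual_space scl. \<forall>g\<in>dual_space scl. F (\<lambda>x. f x + g x) = F f + F g) \<and>
    (\<forall>c. \<forall>f\<in>dual_space scl. F (\<lambda>x. c * f x) = c * F f) \<and>
    (\<exists>K. \<forall>f\<in>dual_space scl. norm (F f) \<le> K * onorm f)}"

definition reflexive_space ::
    "('k::{real_normed_field,euclidean_space} \<Rightarrow> 'a::banach \<Rightarrow> 'a) \<Rightarrow> bool"
  where "reflexive_space scl \<longleftrightarrow>
    (\<forall>F\<in>bidual_space scl. \<exists>x. \<forall>f\<in>dual_space scl. F f = f x)"

text \<open>
  Operators on a subspace \<open>V\<close> are represented by functions that are \<open>undefined\<close> outside \<open>V\<close>
  (no restriction if \<open>V = UNIV\<close>), as in \<^const>\<open>BijGroup\<close>, of which \<open>GL scl V\<close> is a subgroup.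
\<close>

definition linear_automorphisms ::
    "('k \<Rightarrow> 'a::real_normed_vector \<Rightarrow> 'a) \<Rightarrow> 'a set \<Rightarrow> ('a \<Rightarrow> 'a) set"
  where "linear_automorphisms scl V = {T \<in> Bij V.
    (\<forall>x\<in>V. \<forall>y\<in>V. T (x + y) = T x + T y) \<and>
    (\<forall>c. \<forall>x\<in>V. T (scl c x) = scl c (T x)) \<and>
    continuous_on V T \<and> continuous_on V (inv_into V T)}"

definition GL :: "('k \<Rightarrow> 'a::real_normed_vector \<Rightarrow> 'a) \<Rightarrow> 'a set \<Rightarrow> ('a \<Rightarrow> 'a) monoid"
  where "GL scl V = (BijGroup V)\<lparr>carrier := linear_automorphisms scl V\<rparr>"

text \<open>
  The strong operator topology is the topology of pointwise convergence on \<open>V\<close> in norm.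
\<close>

definition SOT :: "'a::real_normed_vector set \<Rightarrow> ('a \<Rightarrow> 'a) topology"
  where "SOT V = product_topology (\<lambda>_. top_of_set V) V"

definition bounded_operators :: "('a::real_normed_vector \<Rightarrow> 'a) set \<Rightarrow> bool"
  where "bounded_operators G \<longleftrightarrow> bdd_above (onorm ` G)"

definition invariant_under :: "('a \<Rightarrow> 'a) set \<Rightarrow> 'a set \<Rightarrow> bool"
  where "invariant_under G W \<longleftrightarrow> (\<forall>T\<in>G. T ` W \<subseteq> W)"

definition proj_along :: "'a::ab_group_add set \<Rightarrow> 'a set \<Rightarrow> 'a \<Rightarrow> 'a"
  where "proj_along V W x = (THE v. v \<in> V \<and> x - v \<in> W)"

text \<open>
  The diagonal entry at \<open>V\<close> of the block matrix of an operator with respect to the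
  decomposition into \<open>V\<close> and \<open>W\<close>. For the decomposition into \<open>Y\<close> and \<open>Z\<close>,
  the entry \<open>u\<close> of \<open>T\<close> is \<open>diag_block Y Z T\<close> and the entry \<open>v\<close> is \<open>diag_block Z Y T\<close>.
\<close>

definition diag_block :: "'a::ab_group_add set \<Rightarrow> 'a set \<Rightarrow> ('a \<Rightarrow> 'a) \<Rightarrow> 'a \<Rightarrow> 'a"
  where "diag_block V W T = (\<lambda>x\<in>V. proj_along V W (T x))"

definition topological_group_iso ::
    "('a, 'c) monoid_scheme \<Rightarrow> 'a topology \<Rightarrow> ('b, 'd) monoid_scheme \<Rightarrow> 'b topology \<Rightarrow> ('a \<Rightarrow> 'b) \<Rightarrow> bool"
  where "topological_group_iso G S H T h \<longleftrightarrow>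
    h \<in> iso G H \<and> homeomorphic_map (subtopology S (carrier G)) (subtopology T (carrier H)) h"

definition sot_iso_onto_image ::
    "('k \<Rightarrow> 'a::real_normed_vector \<Rightarrow> 'a) \<Rightarrow> ('a \<Rightarrow> 'a) set \<Rightarrow> 'a set \<Rightarrow> (('a \<Rightarrow> 'a) \<Rightarrow> 'a \<Rightarrow> 'a) \<Rightarrow> bool"
  where "sot_iso_onto_image scl G V h \<longleftrightarrow>
    subgroup (h ` G) (GL scl V) \<and>
    topological_group_iso
      ((GL scl UNIV)\<lparr>carrier := G\<rparr>) (SOT UNIV)
      ((GL scl V)\<lparr>carrier := h ` G\<rparr>) (SOT V) h"

end

theory Submission
  imports Defs
begin

text \<open>
  Call a net in \<open>G\<close> trivial at \<open>Y\<close> (or at \<open>Z\<close>) if its diagonal blocks at that summand tend to the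
  identity pointwise in norm. Everything reduces to one claim: if \<open>T\<close> runs through such a net, then
  \<open>T x \<longlonglongrightarrow> x\<close> for every \<open>x\<close>. By translation this is the continuity of the inverse of the block map,
  and for a constant net it is injectivity.

  Let \<open>W\<close> be the set of the vectors \<open>x\<close> for which the claim holds, and let \<open>H\<close> be the common kernel of
  the functionals \<open>f\<close> with \<open>f \<circ> T \<longlonglongrightarrow> f\<close> pointwise along all these nets. Both are closed and invariant
  under \<open>G\<close>, because conjugation by an element of \<open>G\<close> preserves triviality. The main point is that
  \<open>X = W \<oplus> H\<close> (\<open>complementary_continuous_vectors\<close>), an analogue of the Alaoglu-Birkhoff
  decomposition in which the vectors that are fixed by a group are replaced by those that are almost
  fixed by its elements near the identity. For the block at \<open>Y\<close>, clearly \<open>Y \<subseteq> W\<close>. As nothing lies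
  strictly between \<open>Y\<close> and \<open>X\<close>, either \<open>W = X\<close>, which is the claim, or \<open>W = Y\<close>, and then \<open>H\<close> would
  be an invariant complement of \<open>Y\<close>. For the block at \<open>Z\<close>, a functional that vanishes on \<open>Y\<close> only sees
  that block, so the Hahn-Banach theorem gives \<open>H \<subseteq> Y\<close>. Hence \<open>H = {0}\<close>, which gives \<open>W = X\<close>, or
  \<open>H = Y\<close>, and then \<open>W\<close> would be an invariant complement.

  To obtain the decomposition one finds, for each \<open>x\<close>, a point of \<open>W\<close> in the intersection \<open>C\<close> of the
  weakly closed convex hulls of \<open>{T x | T \<in> P}\<close>, where \<open>P\<close> runs through the neighbourhoods of the
  identity (\<open>limit_hull_continuity_point\<close>); the same for the dual action. By Zorn's lemma and weak
  compactness there is a minimal \<open>G\<close>-invariant bounded weakly closed convex set \<open>D\<close> that meets \<open>C\<close>. By the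
  separability of the dual pair, \<open>D\<close> has slices of arbitrarily small diameter (\<open>small_slice\<close>). If the
  translates of such a slice are removed from \<open>D\<close>, a smaller invariant set remains, which must miss \<open>C\<close>; so
  every point of \<open>D \<inter> C\<close> lies in small slices of \<open>D\<close>. Such points are extreme in \<open>D\<close>, so the convex
  set \<open>D \<inter> C\<close> is a single point \<open>c\<close>, and \<open>T c \<in> D\<close> eventually enters each slice around \<open>c\<close>, that is,
  \<open>T c \<longlonglongrightarrow> c\<close> in norm. The functionals that define \<open>H\<close> take the same value at \<open>x\<close> and at \<open>c\<close>, so
  \<open>x - c \<in> H\<close>. Dually, a functional with \<open>f x \<noteq> 0\<close> at a point \<open>x \<in> W\<close> can be averaged to one of those
  that define \<open>H\<close>, with the same value at \<open>x\<close>, so \<open>W \<inter> H = {0}\<close>.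
\<close>

section \<open>The Hahn-Banach theorem\<close>

definition sublinear :: "('a::real_vector \<Rightarrow> real) \<Rightarrow> bool"
  where "sublinear p \<longleftrightarrow> (\<forall>x y. p (x + y) \<le> p x + p y) \<and> (\<forall>t\<ge>0. \<forall>x. p (t *\<^sub>R x) = t * p x)"

lemma sublinearD:
  assumes "sublinear p"
  shows "p (x + y) \<le> p x + p y" "0 \<le> t \<Longrightarrow> p (t *\<^sub>R x) = t * p x" "p 0 = 0" "- p (- x) \<le> p x"
proof -
  show 1: "p (x + y) \<le> p x + p y" for x y
    using assms unfolding sublinear_def by blast
  show 2: "p (t *\<^sub>R x) = t * p x" if "0 \<le> t" for t x
    using assms that unfolding sublinear_def by blast
  show 3: "p 0 = 0"
    using 2[of 0 0] by simp
  show "- p (- x) \<le> p x"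
    using 1[of x "- x"] 3 by simp
qed

text \<open>
  The infimum pushes \<open>p\<close> down as far as possible in the direction \<open>y\<close> while staying sublinear. A
  minimal sublinear functional cannot be pushed down, which forces it to be additive. Taking the
  tilted functional at the outset forces a linear minorant to agree with \<open>p\<close> at \<open>y\<close>.
\<close>

lemma sublinear_tilt:
  fixes p :: "'a::real_vector \<Rightarrow> real" and y :: 'a
  assumes p: "sublinear p"
  defines "q \<equiv> \<lambda>x. INF t\<in>{0..}. p (x + t *\<^sub>R y) - t * p y"
  shows "sublinear q" and "q x \<le> p x" and "q x \<le> p (x + y) - p y"
proof -
  note P = sublinearD[OF p]
  have low: "- p (- x) \<le> p (x + t *\<^sub>R y) - t * p y" if "0 \<le> t" for t x
    using P(1)[of "x + t *\<^sub>R y" "- x"] P(2)[OF that, of y] by (simp add: algebra_simps)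
  have bdd: "bdd_below ((\<lambda>t. p (x + t *\<^sub>R y) - t * p y) ` {0..})" for x
    by (rule bdd_belowI2[of _ "- p (- x)"]) (use low in auto)
  have q_le: "q x \<le> p (x + t *\<^sub>R y) - t * p y" if "0 \<le> t" for t x
    unfolding q_def by (rule cINF_lower[OF bdd]) (use that in auto)
  have q_ge: "c \<le> q x" if "\<And>t. 0 \<le> t \<Longrightarrow> c \<le> p (x + t *\<^sub>R y) - t * p y" for c x
    unfolding q_def by (rule cINF_greatest) (use that in auto)
  show "q x \<le> p x"
    using q_le[of 0 x] by simp
  show "q x \<le> p (x + y) - p y"
    using q_le[of 1 x] by simp
  have add: "q (x + z) \<le> q x + q z" for x z
  proof -
    have "q (x + z) - (p (z + s *\<^sub>R y) - s * p y) \<le> q x" if s: "0 \<le> s" for s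
    proof (rule q_ge)
      fix t :: real assume t: "0 \<le> t"
      have "q (x + z) \<le> p (x + z + (t + s) *\<^sub>R y) - (t + s) * p y"
        using q_le s t by simp
      also have "\<dots> \<le> p (x + t *\<^sub>R y) + p (z + s *\<^sub>R y) - (t + s) * p y"
        using P(1)[of "x + t *\<^sub>R y" "z + s *\<^sub>R y"] by (simp add: algebra_simps)
      finally show "q (x + z) - (p (z + s *\<^sub>R y) - s * p y) \<le> p (x + t *\<^sub>R y) - t * p y"
        by (simp add: algebra_simps)
    qed
    then have "q (x + z) - q x \<le> q z"
      by (intro q_ge) (simp add: algebra_simps)
    then show ?thesis by simp
  qed
  have scale_le: "q (s *\<^sub>R x) \<le> s * q x" if s: "0 < s" for s x
  proof -
    have "q (s *\<^sub>R x) / s \<le> q x"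
    proof (rule q_ge)
      fix t :: real assume t: "0 \<le> t"
      have "q (s *\<^sub>R x) \<le> p (s *\<^sub>R x + (s * t) *\<^sub>R y) - (s * t) * p y"
        using q_le s t by simp
      also have "\<dots> = s * (p (x + t *\<^sub>R y) - t * p y)"
        using P(2)[of s "x + t *\<^sub>R y"] s by (simp add: algebra_simps)
      finally show "q (s *\<^sub>R x) / s \<le> p (x + t *\<^sub>R y) - t * p y"
        using s by (simp add: divide_le_eq mult.commute)
    qed
    then show ?thesis
      using s by (simp add: divide_le_eq mult.commute)
  qed
  have scale: "q (s *\<^sub>R x) = s * q x" if s: "0 < s" for s x
  proof (rule antisym)
    show "q (s *\<^sub>R x) \<le> s * q x"
      using scale_le[OF s] .
    show "s * q x \<le> q (s *\<^sub>R x)"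
      using scale_le[of "1 / s" "s *\<^sub>R x"] s by (simp add: field_simps)
  qed
  have q0: "q 0 = 0"
    using q_le[of 0 0] q_ge[of 0 0] P(2,3) by (auto intro: antisym)
  show "sublinear q"
    unfolding sublinear_def
    using add scale q0 by (auto simp: le_less)
qed

lemma minimal_sublinear_linear:
  assumes p: "sublinear p" and min: "\<And>q. sublinear q \<Longrightarrow> (\<And>x. q x \<le> p x) \<Longrightarrow> q = p"
  shows "linear p"
proof -
  note P = sublinearD[OF p]
  have tilt: "p x \<le> p (x + y) - p y" for x y
  proof -
    let ?q = "\<lambda>x. INF t\<in>{0..}. p (x + t *\<^sub>R y) - t * p y"
    have "?q = p"
      by (rule min) (rule sublinear_tilt[OF p])+
    then have "p x = ?q x"
      by (rule fun_cong[OF sym])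
    also have "\<dots> \<le> p (x + y) - p y"
      by (rule sublinear_tilt(3)[OF p])
    finally show ?thesis .
  qed
  have add: "p (x + y) = p x + p y" for x y
    using tilt[of x y] P(1)[of x y] by simp
  have minus: "p (- x) = - p x" for x
    using add[of x "- x"] P(3) by simp
  have "p (t *\<^sub>R x) = t *\<^sub>R p x" for t x
  proof (cases "0 \<le> t")
    case False
    then show ?thesis
      using P(2)[of "- t" x] minus[of "t *\<^sub>R x"] by simp
  qed (simp add: P(2))
  with add show ?thesis
    by (simp add: linear_iff)
qed

lemma linear_below_sublinear:
  assumes p: "sublinear p"
  shows "\<exists>f. linear f \<and> (\<forall>x. f x \<le> p x)"
proof -
  define A where "A = {q. sublinear q \<and> (\<forall>x. q x \<le> p x)}"
  have "\<exists>m\<in>A. \<forall>q\<in>A. (\<forall>x. q x \<le> m x) \<longrightarrow> q = m"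
  proof (rule predicate_Zorn)
    show "partial_order_on A (relation_of (\<lambda>m q. \<forall>x. q x \<le> m x) A)"
      by (rule partial_order_on_relation_ofI) (auto intro: order_trans antisym simp: fun_eq_iff)
    fix C assume C: "C \<in> Chains (relation_of (\<lambda>m q. \<forall>x. q x \<le> m x) A)"
    have CA: "C \<subseteq> A"
      using C unfolding Chains_def relation_of_def by blast
    have chain: "(\<forall>x. a x \<le> b x) \<or> (\<forall>x. b x \<le> a x)" if "a \<in> C" "b \<in> C" for a b
      using C that unfolding Chains_def relation_of_def by blast
    show "\<exists>u\<in>A. \<forall>q\<in>C. \<forall>x. u x \<le> q x"
    proof (cases "C = {}")
      case True
      then show ?thesis using p unfolding A_def by auto
    next
      case False
      define u where "u = (\<lambda>x. INF q\<in>C. q x)"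
      have low: "- p (- x) \<le> q x" if "q \<in> C" for q x
        using that CA sublinearD(4)[of q x] unfolding A_def
        by (smt (verit, best) mem_Collect_eq subsetD)
      have u_le: "u x \<le> q x" if "q \<in> C" for q x
        unfolding u_def
        by (rule cINF_lower[OF bdd_belowI2[of _ "- p (- x)"]]) (use low that in auto)
      have u_ge: "c \<le> u x" if "\<And>q. q \<in> C \<Longrightarrow> c \<le> q x" for c x
        unfolding u_def by (rule cINF_greatest) (use that False in auto)
      have subl: "sublinear q" if "q \<in> C" for q
        using that CA unfolding A_def by auto
      have add: "u (x + y) \<le> u x + u y" for x y
      proof -
        have "u (x + y) - b y \<le> u x" if b: "b \<in> C" for b
        proof (rule u_ge)
          fix a assume a: "a \<in> C"
          show "u (x + y) - b y \<le> a x"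
            using chain[OF a b] u_le[OF a, of "x + y"] u_le[OF b, of "x + y"]
              sublinearD(1)[OF subl[OF a], of x y] sublinearD(1)[OF subl[OF b], of x y]
            by (smt (verit, best))
        qed
        then have "u (x + y) - u x \<le> u y"
          by (intro u_ge) (simp add: algebra_simps)
        then show ?thesis by simp
      qed
      have scale_le: "t * u x \<le> u (t *\<^sub>R x)" if "0 \<le> t" for t x
      proof (rule u_ge)
        fix q assume q: "q \<in> C"
        show "t * u x \<le> q (t *\<^sub>R x)"
          using mult_left_mono[OF u_le[OF q] that] sublinearD(2)[OF subl[OF q] that] by simp
      qed
      have scale: "u (t *\<^sub>R x) = t * u x" if t: "0 \<le> t" for t x
      proof (cases "t = 0")
        case True
        obtain q where "q \<in> C" using False by blast
        with True show ?thesis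
          using u_le[of q 0] scale_le[of 0 x] sublinearD(3)[OF subl] by force
      next
        case ne: False
        have "1 / t * u (t *\<^sub>R x) \<le> u x"
          using scale_le[of "1 / t" "t *\<^sub>R x"] t ne by simp
        then have "u (t *\<^sub>R x) \<le> t * u x"
          using t ne by (simp add: field_simps)
        then show ?thesis
          using scale_le[OF t] antisym by blast
      qed
      obtain q where "q \<in> C" using False by blast
      then have "u x \<le> p x" for x
        using u_le[of q x] CA unfolding A_def by (auto intro: order_trans)
      then have "u \<in> A"
        using add scale unfolding A_def sublinear_def by blast
      then show ?thesis using u_le by auto
    qed
  qed
  then obtain m where m: "sublinear m" "\<And>x. m x \<le> p x"
    and min: "\<And>q. q \<in> A \<Longrightarrow> (\<And>x. q x \<le> m x) \<Longrightarrow> q = m"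
    unfolding A_def by auto
  have "linear m"
  proof (rule minimal_sublinear_linear[OF m(1)])
    fix q assume q: "sublinear q" "\<And>x. q x \<le> m x"
    then have "q \<in> A"
      using m(2) unfolding A_def by (auto intro: order_trans)
    with q show "q = m" using min by blast
  qed
  with m show ?thesis by blast
qed

theorem Hahn_Banach_sublinear:
  assumes p: "sublinear p"
  obtains f where "linear f" "\<And>x. f x \<le> p x" "f y = p y"
proof -
  let ?q = "\<lambda>x. INF t\<in>{0..}. p (x + t *\<^sub>R y) - t * p y"
  obtain f where f: "linear f" "\<And>x. f x \<le> ?q x"
    using linear_below_sublinear[OF sublinear_tilt(1)[OF p]] by blast
  have fp: "f x \<le> p x" for x
    using f(2)[of x] sublinear_tilt(2)[OF p, where x=x] by (rule order_trans)
  have "f (- y) \<le> p (- y + y) - p y"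
    using f(2) sublinear_tilt(3)[OF p, where x="- y"] by (rule order_trans)
  then have "p y \<le> f y"
    using linear_neg[OF f(1)] sublinearD(3)[OF p] by simp
  with fp have "f y = p y"
    using antisym by blast
  with f(1) fp that show thesis by blast
qed

corollary norming_functional:
  fixes x :: "'a::real_normed_vector"
  obtains f :: "'a \<Rightarrow>\<^sub>L real" where "norm f \<le> 1" "f x = norm x"
proof -
  have "sublinear (norm :: 'a \<Rightarrow> real)"
    unfolding sublinear_def by (simp add: norm_triangle_ineq)
  then obtain f where f: "linear f" "\<And>z. f z \<le> norm z" "f x = norm x"
    by (rule Hahn_Banach_sublinear[where y=x]) blast
  have bd: "\<bar>f z\<bar> \<le> norm z" for z
    using f(2)[of z] f(2)[of "- z"] linear_neg[OF f(1)] by (simp add: abs_le_iff)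
  have "bounded_linear f"
    by (rule bounded_linear_intro[of _ 1]) (use f(1) bd in \<open>auto simp: linear_add linear_scale\<close>)
  then have app: "blinfun_apply (Blinfun f) = f"
    by (rule bounded_linear_Blinfun_apply)
  show thesis
  proof
    show "norm (Blinfun f) \<le> 1"
      by (rule norm_blinfun_bound) (use bd in \<open>auto simp: app\<close>)
    show "Blinfun f x = norm x"
      using f(3) by (simp add: app)
  qed
qed

text \<open>
  The distance to \<open>L\<close> is a seminorm that vanishes exactly on \<open>L\<close>.
\<close>

corollary separating_functional:
  fixes L :: "'a::real_normed_vector set"
  assumes L: "subspace L" "closed L" and x: "x \<notin> L"
  obtains f :: "'a \<Rightarrow>\<^sub>L real" where "\<And>z. z \<in> L \<Longrightarrow> f z = 0" "f x \<noteq> 0"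
proof -
  have L0: "0 \<in> L" using L(1) by (rule subspace_0)
  define p where "p = (\<lambda>z. infdist z L)"
  have p_le: "p z \<le> norm (z - l)" if "l \<in> L" for z l
    using infdist_le[OF that] unfolding p_def dist_norm .
  have p_ge: "c \<le> p z" if "\<And>l. l \<in> L \<Longrightarrow> c \<le> norm (z - l)" for c z
    unfolding p_def infdist_def dist_norm using L0 that by (auto intro!: cINF_greatest)
  have add: "p (z + w) \<le> p z + p w" for z w
  proof -
    have "p (z + w) - norm (w - l) \<le> p z" if l: "l \<in> L" for l
    proof (rule p_ge)
      fix k assume "k \<in> L"
      then have "p (z + w) \<le> norm ((z + w) - (k + l))"
        using p_le subspace_add[OF L(1)] l by blast
      also have "\<dots> \<le> norm (z - k) + norm (w - l)"
        by (metis add_diff_add norm_triangle_ineq)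
      finally show "p (z + w) - norm (w - l) \<le> norm (z - k)" by simp
    qed
    then have "p (z + w) - p z \<le> p w"
      by (intro p_ge) (simp add: algebra_simps)
    then show ?thesis by simp
  qed
  have scale_le: "t * p z \<le> p (t *\<^sub>R z)" if t: "0 < t" for t z
  proof (rule p_ge)
    fix l assume "l \<in> L"
    then have "p z \<le> norm (z - (1 / t) *\<^sub>R l)"
      using p_le subspace_scale[OF L(1)] by blast
    then have "t * p z \<le> norm (t *\<^sub>R (z - (1 / t) *\<^sub>R l))"
      using t by simp
    then show "t * p z \<le> norm (t *\<^sub>R z - l)"
      using t by (simp add: algebra_simps)
  qed
  have "p (t *\<^sub>R z) = t * p z" if "0 \<le> t" for t z
  proof (cases "t = 0")
    case True
    then show ?thesis using L0 unfolding p_def by simp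
  next
    case False
    with that scale_le[of "1 / t" "t *\<^sub>R z"] scale_le[of t z] show ?thesis
      by (simp add: field_simps)
  qed
  with add have "sublinear p"
    unfolding sublinear_def by blast
  then obtain f where f: "linear f" "\<And>z. f z \<le> p z" "f x = p x"
    by (rule Hahn_Banach_sublinear[where y=x]) blast
  have "f z \<le> norm z" for z
    using f(2)[of z] p_le[OF L0, of z] by simp
  then have bd: "\<bar>f z\<bar> \<le> norm z" for z
    using linear_neg[OF f(1)] by (metis abs_le_iff norm_minus_cancel)
  have "bounded_linear f"
    by (rule bounded_linear_intro[of _ 1]) (use f(1) bd in \<open>auto simp: linear_add linear_scale\<close>)
  then have app: "blinfun_apply (Blinfun f) = f"
    by (rule bounded_linear_Blinfun_apply)
  have "p x \<noteq> 0"
    using x L(2) L0 unfolding p_def by (metis empty_iff in_closed_iff_infdist_zero)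
  moreover have "f z = 0" if "z \<in> L" for z
  proof -
    have "p z = 0" "p (- z) = 0"
      using that subspace_neg[OF L(1) that] unfolding p_def by auto
    then show ?thesis
      using f(2)[of z] f(2)[of "- z"] linear_neg[OF f(1), of z] by simp
  qed
  ultimately show thesis
    using that[of "Blinfun f"] f(3) by (simp add: app)
qed

section \<open>Weak compactness and small slices in dual pairs\<close>

lemma Baire_countable_closed_cover:
  fixes \<G> :: "'a::complete_space set set"
  assumes "countable \<G>" "\<And>T. T \<in> \<G> \<Longrightarrow> closed T" "\<Union>\<G> = UNIV"
  obtains T where "T \<in> \<G>" "interior T \<noteq> {}"
proof -
  have "\<not> (\<forall>T\<in>\<G>. interior T = {})"
  proof
    assume "\<forall>T\<in>\<G>. interior T = {}"
    then have "euclidean interior_of \<Union>\<G> = {}"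
      using assms(1,2)
      by (intro Baire_category_alt disjI1 completely_metrizable_space_euclidean) auto
    with assms(3) show False by simp
  qed
  with that show thesis by blast
qed

text \<open>
  A dual pair presents \<open>'m\<close> as the norm dual of the Banach space \<open>'e\<close> without fixing a model of it, so
  that a space and its dual can be treated alike: a reflexive space is the dual of its dual. Weak
  notions on \<open>'m\<close> refer to the functionals that come from \<open>'e\<close>.
\<close>

locale dual_pair = bounded_bilinear B
  for B :: "'e::banach \<Rightarrow> 'm::real_normed_vector \<Rightarrow> real" +
  assumes abs_le: "\<bar>B e m\<bar> \<le> norm e * norm m"
    and norming: "0 \<le> c \<Longrightarrow> (\<And>e. \<bar>B e m\<bar> \<le> c * norm e) \<Longrightarrow> norm m \<le> c"
    and representable: "bounded_linear \<phi> \<Longrightarrow> \<exists>m. \<forall>e. \<phi> e = B e m"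
    and separable: "\<exists>Q::'m set. countable Q \<and> closure Q = UNIV"
begin

lemma separating: "(\<And>e. B e m = B e m') \<Longrightarrow> m = m'"
  using norming[of 0 "m - m'"] by (simp add: diff_right)

text \<open>
  By the separation theorem this is the weakly closed convex hull. The description by half-spaces makes
  convexity and weak closedness evident and is stable under operators with a pre-adjoint.
\<close>

definition weak_hull :: "'m set \<Rightarrow> 'm set"
  where "weak_hull S = {m. \<forall>e \<alpha>. (\<forall>s\<in>S. B e s \<le> \<alpha>) \<longrightarrow> B e m \<le> \<alpha>}"

definition weakly_closed_convex :: "'m set \<Rightarrow> bool"
  where "weakly_closed_convex D \<longleftrightarrow> weak_hull D \<subseteq> D"

lemma weak_hullD: "m \<in> weak_hull S \<Longrightarrow> (\<And>s. s \<in> S \<Longrightarrow> B e s \<le> \<alpha>) \<Longrightarrow> B e m \<le> \<alpha>"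
  unfolding weak_hull_def by blast

lemma weak_hull_superset: "S \<subseteq> weak_hull S"
  unfolding weak_hull_def by blast

lemma weak_hull_mono: "S \<subseteq> S' \<Longrightarrow> weak_hull S \<subseteq> weak_hull S'"
  unfolding weak_hull_def by blast

lemma weakly_closed_convex_weak_hull: "weakly_closed_convex (weak_hull S)"
  unfolding weakly_closed_convex_def weak_hull_def by blast

lemma weakly_closed_convex_Inter:
  "(\<And>D. D \<in> \<D> \<Longrightarrow> weakly_closed_convex D) \<Longrightarrow> weakly_closed_convex (\<Inter>\<D>)"
  unfolding weakly_closed_convex_def using weak_hull_mono by (meson Inter_greatest Inter_lower subset_trans)

lemma weakly_closed_convex_Int:
  "weakly_closed_convex D \<Longrightarrow> weakly_closed_convex D' \<Longrightarrow> weakly_closed_convex (D \<inter> D')"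
  using weakly_closed_convex_Inter[of "{D, D'}"] by auto

lemma weakly_closed_convex_le: "weakly_closed_convex {m. B e m \<le> \<alpha>}"
  unfolding weakly_closed_convex_def using weak_hullD by blast

lemma weakly_closed_convex_ge: "weakly_closed_convex {m. \<alpha> \<le> B e m}"
  using weakly_closed_convex_le[of "- e" "- \<alpha>"] by (simp add: minus_left)

lemma weakly_closed_convex_midpoint:
  assumes "weakly_closed_convex D" "m \<in> D" "m' \<in> D"
  shows "(1/2) *\<^sub>R (m + m') \<in> D"
proof -
  have "B e ((1/2) *\<^sub>R (m + m')) \<le> \<alpha>" if "\<forall>d\<in>D. B e d \<le> \<alpha>" for e \<alpha>
  proof -
    have "B e m \<le> \<alpha>" "B e m' \<le> \<alpha>" using that assms by auto
    then show ?thesis by (simp add: scaleR_right add_right)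
  qed
  then have "(1/2) *\<^sub>R (m + m') \<in> weak_hull D"
    unfolding weak_hull_def by blast
  with assms(1) show ?thesis
    unfolding weakly_closed_convex_def by blast
qed

lemma norm_weak_hull_le:
  assumes "m \<in> weak_hull S" "0 \<le> R" "\<And>s. s \<in> S \<Longrightarrow> norm s \<le> R"
  shows "norm m \<le> R"
proof (rule norming[OF assms(2)])
  fix e
  have le: "\<bar>B e s\<bar> \<le> R * norm e" if "s \<in> S" for s
    using abs_le[of e s] assms(3)[OF that] by (smt (verit) mult.commute mult_left_mono norm_ge_zero)
  have "B e m \<le> R * norm e"
    by (rule weak_hullD[OF assms(1)]) (use le in force)
  moreover have "B (- e) m \<le> R * norm e"
    by (rule weak_hullD[OF assms(1)]) (use le in \<open>force simp: minus_left\<close>)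
  ultimately show "\<bar>B e m\<bar> \<le> R * norm e"
    by (simp add: minus_left)
qed

text \<open>
  The Banach-Alaoglu theorem: in the product topology on \<open>'e \<Rightarrow> real\<close>, the image is a closed part of
  a product of compact intervals. It is closed because linearity and membership in half-spaces are
  conditions on finitely many coordinates at a time, and every function that satisfies them comes
  from \<open>'m\<close>.
\<close>

lemma compact_evaluations:
  assumes D: "weakly_closed_convex D" and R: "\<And>m. m \<in> D \<Longrightarrow> norm m \<le> R"
  shows "compact ((\<lambda>m e. B e m) ` D)" and "closed ((\<lambda>m e. B e m) ` D)"
proof -
  let ?box = "PiE UNIV (\<lambda>e::'e. {- (R * norm e)..R * norm e})"
  define L where "L = {\<phi>. (\<forall>x y. \<phi> (x + y) = \<phi> x + \<phi> y) \<and> (\<forall>c x. \<phi> (c *\<^sub>R x) = c * \<phi> x) \<and>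
    (\<forall>e \<alpha>. (\<forall>d\<in>D. B e d \<le> \<alpha>) \<longrightarrow> \<phi> e \<le> \<alpha>)}"
  have eq: "(\<lambda>m e. B e m) ` D = ?box \<inter> L"
  proof (intro equalityI subsetI)
    fix \<phi> assume "\<phi> \<in> (\<lambda>m e. B e m) ` D"
    then obtain m where m: "m \<in> D" "\<phi> = (\<lambda>e. B e m)" by blast
    have "\<bar>B e m\<bar> \<le> R * norm e" for e
      using abs_le[of e m] R[OF m(1)] by (smt (verit) mult.commute mult_left_mono norm_ge_zero)
    then have "- (R * norm e) \<le> B e m \<and> B e m \<le> R * norm e" for e
      by (smt (verit))
    then have "\<phi> \<in> ?box"
      unfolding m(2) by auto
    moreover have "\<phi> \<in> L"
      unfolding L_def m(2) using m(1) by (simp add: add_left scaleR_left)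
    ultimately show "\<phi> \<in> ?box \<inter> L" by blast
  next
    fix \<phi> assume \<phi>: "\<phi> \<in> ?box \<inter> L"
    have bd: "norm (\<phi> e) \<le> norm e * R" for e
    proof -
      have "\<phi> e \<in> {- (R * norm e)..R * norm e}"
        using \<phi> by (simp add: PiE_iff)
      then show ?thesis
        by (auto simp: mult.commute intro: abs_leI)
    qed
    have add: "\<phi> (x + y) = \<phi> x + \<phi> y" and scale: "\<phi> (c *\<^sub>R x) = c *\<^sub>R \<phi> x" for x y c
      using \<phi> by (simp_all add: L_def)
    have "bounded_linear \<phi>"
      by (rule bounded_linear_intro[OF add scale bd])
    then obtain m where m: "\<And>e. \<phi> e = B e m"
      using representable by blast
    have "m \<in> weak_hull D"
      using \<phi> unfolding weak_hull_def L_def m by blast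
    then have "m \<in> D"
      using D unfolding weakly_closed_convex_def by blast
    moreover have "\<phi> = (\<lambda>e. B e m)"
      using m by (rule ext)
    ultimately show "\<phi> \<in> (\<lambda>m e. B e m) ` D"
      by blast
  qed
  have "compactin (product_topology (\<lambda>_. euclidean) UNIV) ?box"
    unfolding compactin_PiE by auto
  then have box: "compact ?box"
    unfolding euclidean_product_topology by simp
  note coordinate = continuous_on_product_coordinates[where 'b = real]
  have "L = (\<Inter>x. \<Inter>y. {\<phi>. \<phi> (x + y) = \<phi> x + \<phi> y}) \<inter> (\<Inter>c. \<Inter>x. {\<phi>. \<phi> (c *\<^sub>R x) = c * \<phi> x}) \<inter>
      (\<Inter>e. \<Inter>\<alpha>\<in>{\<alpha>. \<forall>d\<in>D. B e d \<le> \<alpha>}. {\<phi>. \<phi> e \<le> \<alpha>})"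
    unfolding L_def by blast
  also have "closed \<dots>"
    by (intro closed_Int closed_INT ballI closed_Collect_eq closed_Collect_le
        continuous_on_add continuous_on_mult_left continuous_on_const coordinate)
  finally have "closed L" .
  with box show "compact ((\<lambda>m e. B e m) ` D)"
    unfolding eq by (rule compact_Int_closed)
  have "closed {\<phi>::'e \<Rightarrow> real. \<forall>e. - (R * norm e) \<le> \<phi> e \<and> \<phi> e \<le> R * norm e}"
    by (intro closed_Collect_conj closed_Collect_all closed_Collect_le continuous_on_const coordinate)
  moreover have "?box = {\<phi>. \<forall>e. - (R * norm e) \<le> \<phi> e \<and> \<phi> e \<le> R * norm e}"
    by (auto simp: PiE_iff)
  ultimately have "closed ?box"
    by (simp only:)
  then show "closed ((\<lambda>m e. B e m) ` D)"
    unfolding eq using \<open>closed L\<close> by (rule closed_Int)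
qed

lemma directed_Inter_nonempty:
  assumes dir: "\<And>D D'. D \<in> \<D> \<Longrightarrow> D' \<in> \<D> \<Longrightarrow> \<exists>D''\<in>\<D>. D'' \<subseteq> D \<inter> D'"
    and wcc: "\<And>D. D \<in> \<D> \<Longrightarrow> weakly_closed_convex D" and ne: "{} \<notin> \<D>"
    and D0: "D0 \<in> \<D>" "\<And>m. m \<in> D0 \<Longrightarrow> norm m \<le> R"
  shows "\<Inter>\<D> \<noteq> {}"
proof -
  let ?ev = "\<lambda>m e. B e m"
  let ?F = "(\<lambda>D. ?ev ` (D0 \<inter> D)) ` \<D>"
  have "?ev ` D0 \<inter> \<Inter>?F \<noteq> {}"
  proof (rule compact_imp_fip)
    show "compact (?ev ` D0)"
      by (rule compact_evaluations(1)[OF wcc[OF D0(1)] D0(2)])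
    fix T assume "T \<in> ?F"
    then obtain D where D: "D \<in> \<D>" "T = ?ev ` (D0 \<inter> D)" by blast
    show "closed T"
      unfolding D(2)
      by (rule compact_evaluations(2)[OF weakly_closed_convex_Int[OF wcc[OF D0(1)] wcc[OF D(1)]], of R])
        (use D0(2) in blast)
  next
    fix F' assume "finite F'" "F' \<subseteq> ?F"
    then have "\<exists>\<F>\<subseteq>\<D>. finite \<F> \<and> F' = (\<lambda>D. ?ev ` (D0 \<inter> D)) ` \<F>"
      by (rule finite_subset_image)
    then obtain \<F> where \<F>: "finite \<F>" "\<F> \<subseteq> \<D>" "F' = (\<lambda>D. ?ev ` (D0 \<inter> D)) ` \<F>"
      by (elim exE conjE)
    have "\<exists>D\<in>\<D>. D \<subseteq> D0 \<and> (\<forall>D'\<in>\<F>. D \<subseteq> D')"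
      using \<F>(1,2)
    proof (induction rule: finite_induct)
      case empty
      then show ?case using D0(1) by auto
    next
      case (insert D' \<F>)
      then obtain D where D: "D \<in> \<D>" "D \<subseteq> D0" "\<forall>D'\<in>\<F>. D \<subseteq> D'" by auto
      obtain D'' where "D'' \<in> \<D>" "D'' \<subseteq> D \<inter> D'"
        using dir[OF D(1), of D'] insert.prems by auto
      with D show ?case by (intro bexI[of _ D'']) auto
    qed
    then obtain D where D: "D \<in> \<D>" "D \<subseteq> D0" "\<And>D'. D' \<in> \<F> \<Longrightarrow> D \<subseteq> D'" by blast
    then have "D \<noteq> {}" using ne by auto
    then obtain m where m: "m \<in> D" by blast
    have "?ev m \<in> T" if T: "T \<in> F'" for T
    proof -
      obtain D' where D': "D' \<in> \<F>" "T = ?ev ` (D0 \<inter> D')"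
        using T unfolding \<F>(3) by (rule imageE)
      have "m \<in> D0 \<inter> D'"
        using m D(2) D(3)[OF D'(1)] by blast
      then show ?thesis
        unfolding D'(2) by (rule imageI)
    qed
    moreover have "?ev m \<in> ?ev ` D0"
      using m D(2) by (intro imageI) blast
    ultimately show "?ev ` D0 \<inter> \<Inter>F' \<noteq> {}"
      by (metis (no_types, lifting) IntI InterI empty_iff)
  qed
  then obtain \<phi> where \<phi>: "\<phi> \<in> ?ev ` D0" "\<phi> \<in> \<Inter>?F" by (meson ex_in_conv IntE)
  from \<phi>(1) obtain m where m: "\<phi> = ?ev m" by (rule imageE)
  have "m \<in> D" if "D \<in> \<D>" for D
  proof -
    have "?ev m \<in> ?ev ` (D0 \<inter> D)"
      using InterD[OF \<phi>(2) imageI[OF that]] unfolding m .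
    then obtain m' where m': "m' \<in> D" "?ev m = ?ev m'"
      by (elim imageE IntE)
    then have "m = m'"
      using fun_cong[OF m'(2)] by (intro separating) blast
    with m' show ?thesis by simp
  qed
  then show ?thesis by blast
qed

lemma maximiser_exists:
  assumes D: "weakly_closed_convex D" "D \<noteq> {}" "\<And>m. m \<in> D \<Longrightarrow> norm m \<le> R"
  obtains f where "f \<in> D" "\<And>m. m \<in> D \<Longrightarrow> B e m \<le> B e f"
proof -
  let ?D = "(\<lambda>d. D \<inter> {m. B e d \<le> B e m}) ` D"
  have "\<Inter>?D \<noteq> {}"
  proof (rule directed_Inter_nonempty)
    fix D1 D2 assume "D1 \<in> ?D" "D2 \<in> ?D"
    then obtain d1 d2 where d: "d1 \<in> D" "d2 \<in> D"
      and D12: "D1 = D \<inter> {m. B e d1 \<le> B e m}" "D2 = D \<inter> {m. B e d2 \<le> B e m}" by blast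
    show "\<exists>D''\<in>?D. D'' \<subseteq> D1 \<inter> D2"
    proof (cases "B e d1 \<le> B e d2")
      case True
      then show ?thesis using d unfolding D12 by (intro bexI[of _ "D \<inter> {m. B e d2 \<le> B e m}"]) auto
    next
      case False
      then show ?thesis using d unfolding D12 by (intro bexI[of _ "D \<inter> {m. B e d1 \<le> B e m}"]) auto
    qed
  next
    show "weakly_closed_convex D'" if "D' \<in> ?D" for D'
      using that D(1) weakly_closed_convex_Int weakly_closed_convex_ge by auto
    show "{} \<notin> ?D" by auto
    show "D \<inter> {m. B e (SOME d. d \<in> D) \<le> B e m} \<in> ?D"
      using D(2) some_in_eq by blast
    show "norm m \<le> R" if "m \<in> D \<inter> {m. B e (SOME d. d \<in> D) \<le> B e m}" for m
      using that D(3) by blast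
  qed
  with D(2) that show thesis by auto
qed

text \<open>
  This is the argument by which a Banach space with separable dual is an Asplund space. Let
  \<open>p e\<close> be the maximum of \<open>B e\<close> on \<open>D\<close>. Each \<open>e\<close> has a maximiser in \<open>D\<close>, and by separability countably
  many small balls suffice to catch a maximiser of every \<open>e\<close>. By Baire's theorem, the \<open>e'\<close> with a
  maximiser in one fixed ball are dense near some \<open>e\<close> among them. Thus \<open>p\<close> is almost Frechet
  differentiable at \<open>e\<close>, with derivative the maximiser \<open>f\<close> of \<open>e\<close>, and then almost maximisers of \<open>e\<close>
  are close to \<open>f\<close> in norm.
\<close>

lemma small_slice:
  assumes D: "weakly_closed_convex D" "D \<noteq> {}" "\<And>m. m \<in> D \<Longrightarrow> norm m \<le> R" and \<epsilon>: "0 < \<epsilon>"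
  obtains e \<alpha> where "\<exists>m\<in>D. \<alpha> < B e m"
    "\<And>m m'. m \<in> D \<Longrightarrow> m' \<in> D \<Longrightarrow> \<alpha> < B e m \<Longrightarrow> \<alpha> < B e m' \<Longrightarrow> norm (m - m') \<le> \<epsilon>"
proof -
  \<comment> \<open>points of the slice will lie within \<open>4 * \<eta>\<close> of one point\<close>
  define \<eta> where "\<eta> = \<epsilon> / 8"
  have \<eta>: "0 < \<eta>" using \<epsilon> by (simp add: \<eta>_def)
  define R' where "R' = max R 1"
  have R': "0 < R'" "\<And>m. m \<in> D \<Longrightarrow> norm m \<le> R'"
    using D(3) by (auto simp: R'_def le_max_iff_disj)
  obtain Q :: "'m set" where Q: "countable Q" "closure Q = UNIV"
    using separable by blast
  \<comment> \<open>the \<open>e\<close> that are maximised on \<open>D\<close> by a point within \<open>\<eta>\<close> of \<open>q\<close>\<close>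
  define A where "A q = {e. \<exists>f\<in>D. (\<forall>m\<in>D. B e m \<le> B e f) \<and> norm (f - q) \<le> \<eta>}" for q
  have "\<exists>q\<in>Q. e \<in> closure (A q)" for e
  proof -
    obtain f where f: "f \<in> D" "\<And>m. m \<in> D \<Longrightarrow> B e m \<le> B e f"
      using maximiser_exists[OF D] by blast
    have "f \<in> closure Q" using Q by simp
    then obtain q where q: "q \<in> Q" "dist q f < \<eta>"
      using \<eta> closure_approachable by blast
    then have "norm (f - q) \<le> \<eta>"
      by (simp add: dist_norm norm_minus_commute)
    with f have "e \<in> A q"
      unfolding A_def by blast
    with q(1) show ?thesis
      using closure_subset by blast
  qed
  then have "\<Union>((\<lambda>q. closure (A q)) ` Q) = UNIV"
    by blast
  then obtain T where "T \<in> (\<lambda>q. closure (A q)) ` Q" "interior T \<noteq> {}"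
    by (rule Baire_countable_closed_cover[rotated 2]) (use Q(1) in auto)
  then obtain q where "interior (closure (A q)) \<noteq> {}"
    by blast
  then obtain e0 where "e0 \<in> interior (closure (A q))" by blast
  moreover from this have "e0 \<in> closure (A q)"
    using interior_subset by (rule subsetD[rotated])
  ultimately have "A q \<inter> interior (closure (A q)) \<noteq> {}"
    using open_Int_closure_eq_empty[OF open_interior[of "closure (A q)"], of "A q"]
    by (metis IntI empty_iff inf_commute)
  then obtain e where e: "e \<in> A q" "e \<in> interior (closure (A q))"
    by blast
  then obtain \<rho> where \<rho>: "0 < \<rho>" "ball e \<rho> \<subseteq> closure (A q)"
    using mem_interior by blast
  define \<delta> where "\<delta> = \<rho> / 2"
  have \<delta>: "0 < \<delta>" "\<delta> < \<rho>" using \<rho> by (auto simp: \<delta>_def)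
  obtain f where f: "f \<in> D" "\<And>m. m \<in> D \<Longrightarrow> B e m \<le> B e f" "norm (f - q) \<le> \<eta>"
    using e(1) unfolding A_def by blast
  define \<alpha> where "\<alpha> = B e f - \<eta> * \<delta>"
  have key: "B h (m - f) \<le> 4 * \<eta> * \<delta>" if m: "m \<in> D" "\<alpha> < B e m" and h: "norm h = \<delta>" for m h
  proof -
    \<comment> \<open>\<open>e + h\<close> is now replaced by a point \<open>e'\<close> of \<open>A q\<close> so close that the values on \<open>D\<close> hardly change\<close>
    have "e + h \<in> closure (A q)"
      using \<rho>(2) h \<delta> by (auto simp: dist_norm)
    moreover have pos: "0 < \<eta> * \<delta> / (2 * R')"
      using \<eta> \<delta> R' by simp
    ultimately obtain e' where e': "e' \<in> A q" "dist e' (e + h) < \<eta> * \<delta> / (2 * R')"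
      using closure_approachable by blast
    then obtain f' where f': "f' \<in> D" "\<And>m. m \<in> D \<Longrightarrow> B e' m \<le> B e' f'" "norm (f' - q) \<le> \<eta>"
      unfolding A_def by blast
    have near: "\<bar>B (e' - (e + h)) d\<bar> \<le> \<eta> * \<delta> / 2" if "d \<in> D" for d
    proof -
      have "\<bar>B (e' - (e + h)) d\<bar> \<le> norm (e' - (e + h)) * norm d"
        by (rule abs_le)
      also have "\<dots> \<le> (\<eta> * \<delta> / (2 * R')) * R'"
        using e'(2) R'(2)[OF that] pos by (intro mult_mono) (auto simp: dist_norm)
      finally show ?thesis using R'(1) by simp
    qed
    have "norm (f' - f) \<le> norm (f' - q) + norm (f - q)"
      using norm_triangle_ineq4[of "f' - q" "f - q"] by simp
    then have "norm (f' - f) \<le> 2 * \<eta>"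
      using f(3) f'(3) by simp
    then have "norm h * norm (f' - f) \<le> \<delta> * (2 * \<eta>)"
      using h \<delta>(1) by (intro mult_mono) auto
    then have ff: "B h (f' - f) \<le> \<delta> * (2 * \<eta>)"
      using abs_le[of h "f' - f"] by linarith
    have "B e' m \<le> B e' f'" "B e f' \<le> B e f"
      using f'(2) m(1) f(2) f'(1) by auto
    with near[OF m(1)] near[OF f'(1)] m(2) ff show ?thesis
      unfolding \<alpha>_def diff_left diff_right add_left abs_le_iff by (simp add: algebra_simps)
  qed
  have close: "norm (m - f) \<le> 4 * \<eta>" if m: "m \<in> D" "\<alpha> < B e m" for m
  proof (rule norming)
    fix h
    show "\<bar>B h (m - f)\<bar> \<le> 4 * \<eta> * norm h"
    proof (cases "h = 0")
      case True
      then show ?thesis by (simp add: zero_left)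
    next
      case False
      then have n: "0 < norm h" by simp
      let ?k = "(\<delta> / norm h) *\<^sub>R h"
      have "norm ?k = \<delta>" "norm (- ?k) = \<delta>"
        using False \<delta>(1) by auto
      then have "B ?k (m - f) \<le> 4 * \<eta> * \<delta>" "B (- ?k) (m - f) \<le> 4 * \<eta> * \<delta>"
        using key m by blast+
      then have "\<delta> / norm h * \<bar>B h (m - f)\<bar> \<le> 4 * \<eta> * \<delta>"
        using \<delta>(1) n by (simp add: scaleR_left minus_left abs_if)
      then have "\<delta> * \<bar>B h (m - f)\<bar> \<le> \<delta> * (4 * \<eta> * norm h)"
        using n by (simp add: field_simps)
      then show ?thesis
        using \<delta>(1) by (simp only: mult_le_cancel_left_pos)
    qed
  qed (use \<eta> in simp)
  show thesis
  proof
    show "\<exists>m\<in>D. \<alpha> < B e m"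
      using f(1) \<eta> \<delta> by (auto simp: \<alpha>_def intro!: bexI[of _ f])
    fix m m' assume "m \<in> D" "m' \<in> D" "\<alpha> < B e m" "\<alpha> < B e m'"
    then have "norm (m - f) \<le> 4 * \<eta>" "norm (m' - f) \<le> 4 * \<eta>"
      using close by auto
    then show "norm (m - m') \<le> \<epsilon>"
      using norm_triangle_ineq4[of "m - f" "m' - f"] by (simp add: \<eta>_def)
  qed
qed

end

section \<open>Points of continuity of bounded group actions\<close>

text \<open>
  The index set \<open>A\<close> acts on \<open>'m\<close> as a group of uniformly bounded operators with pre-adjoints on \<open>'e\<close>,
  and \<open>F\<close> plays the role of the filter of neighbourhoods of the identity. The indices are kept
  apart from the operators, and the multiplicative conditions are stated up to equality of the
  operators without reference to a product of indices, so that the adjoint action, which reverses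
  products, is an instance as well.
\<close>

locale near_identity_action = dual_pair B
  for B :: "'e::banach \<Rightarrow> 'm::real_normed_vector \<Rightarrow> real" +
  fixes A :: "'g set" and act :: "'g \<Rightarrow> 'm \<Rightarrow> 'm" and coact :: "'g \<Rightarrow> 'e \<Rightarrow> 'e"
    and K :: real and F :: "'g filter"
  assumes adjoint: "g \<in> A \<Longrightarrow> B e (act g m) = B (coact g e) m"
    and act_bound: "g \<in> A \<Longrightarrow> norm (act g m) \<le> K * norm m"
    and act_one: "\<exists>g\<in>A. \<forall>m. act g m = m"
    and act_inverse: "g \<in> A \<Longrightarrow> \<exists>h\<in>A. \<forall>m. act h (act g m) = m"
    and act_mult: "g \<in> A \<Longrightarrow> h \<in> A \<Longrightarrow> \<exists>k\<in>A. \<forall>m. act k m = act g (act h m)"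
    and F_nontrivial: "F \<noteq> bot"
    and F_carrier: "eventually (\<lambda>g. g \<in> A) F"
    and F_mult: "eventually P F \<Longrightarrow> \<exists>Q. eventually Q F \<and>
      (\<forall>g\<in>A. \<forall>h\<in>A. Q g \<longrightarrow> Q h \<longrightarrow> (\<exists>k\<in>A. P k \<and> (\<forall>m. act k m = act g (act h m))))"
begin

lemma act_diff:
  assumes "g \<in> A"
  shows "act g (m - m') = act g m - act g m'"
  by (rule separating) (simp add: diff_right adjoint[OF assms])

lemma act_dist: "g \<in> A \<Longrightarrow> norm (act g m - act g m') \<le> K * norm (m - m')"
  using act_bound[of g "m - m'"] by (simp add: act_diff)

lemma norm_act_le: "g \<in> A \<Longrightarrow> norm (act g m) \<le> \<bar>K\<bar> * norm m"
  using act_bound[of g m] by (meson abs_ge_self mult_right_mono norm_ge_zero order_trans)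

lemma act_weak_hull:
  assumes g: "g \<in> A" and m: "m \<in> weak_hull S"
  shows "act g m \<in> weak_hull (act g ` S)"
  using m unfolding weak_hull_def by (auto simp: adjoint[OF g])

definition orbit_hull :: "('g \<Rightarrow> bool) \<Rightarrow> 'm \<Rightarrow> 'm set"
  where "orbit_hull P m = weak_hull {act g m | g. g \<in> A \<and> P g}"

text \<open>
  The points that can be reached by averaging \<open>act g m\<close> over \<open>g\<close> arbitrarily near the identity.
\<close>

definition limit_hull :: "'m \<Rightarrow> 'm set"
  where "limit_hull m = (\<Inter>P\<in>{P. eventually P F}. orbit_hull P m)"

lemma weakly_closed_convex_orbit_hull: "weakly_closed_convex (orbit_hull P m)"
  unfolding orbit_hull_def by (rule weakly_closed_convex_weak_hull)

lemma weakly_closed_convex_limit_hull: "weakly_closed_convex (limit_hull m)"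
  unfolding limit_hull_def by (rule weakly_closed_convex_Inter) (use weakly_closed_convex_orbit_hull in blast)

lemma limit_hull_subset_orbit_hull: "eventually P F \<Longrightarrow> limit_hull m \<subseteq> orbit_hull P m"
  unfolding limit_hull_def by blast

lemma orbit_hull_mono: "(\<And>g. P g \<Longrightarrow> Q g) \<Longrightarrow> orbit_hull P m \<subseteq> orbit_hull Q m"
  unfolding orbit_hull_def by (rule weak_hull_mono) blast

lemma norm_orbit_hull: "x \<in> orbit_hull P m \<Longrightarrow> norm x \<le> \<bar>K\<bar> * norm m"
  unfolding orbit_hull_def by (erule norm_weak_hull_le) (use norm_act_le in auto)

lemma orbit_hull_nonempty:
  assumes "eventually P F"
  shows "orbit_hull P m \<noteq> {}"
proof -
  have "eventually (\<lambda>g. g \<in> A \<and> P g) F"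
    using F_carrier assms by (rule eventually_conj)
  then obtain g where "g \<in> A" "P g"
    using F_nontrivial eventually_happens' by blast
  then have "act g m \<in> orbit_hull P m"
    unfolding orbit_hull_def by (intro subsetD[OF weak_hull_superset]) blast
  then show ?thesis by blast
qed

text \<open>
  By weak compactness, missing the limit hull is already visible at one neighbourhood of the identity.
\<close>

lemma meets_limit_hull:
  assumes D: "weakly_closed_convex D"
    and meets: "\<And>P. eventually P F \<Longrightarrow> D \<inter> orbit_hull P m \<noteq> {}"
  shows "D \<inter> limit_hull m \<noteq> {}"
proof -
  let ?D = "(\<lambda>P. D \<inter> orbit_hull P m) ` {P. eventually P F}"
  have "\<Inter>?D \<noteq> {}"
  proof (rule directed_Inter_nonempty)
    fix D1 D2 assume "D1 \<in> ?D" "D2 \<in> ?D"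
    then obtain P1 P2 where P: "eventually P1 F" "eventually P2 F"
      "D1 = D \<inter> orbit_hull P1 m" "D2 = D \<inter> orbit_hull P2 m" by blast
    have "eventually (\<lambda>g. P1 g \<and> P2 g) F"
      using P(1,2) by (rule eventually_conj)
    moreover have "orbit_hull (\<lambda>g. P1 g \<and> P2 g) m \<subseteq> orbit_hull P1 m \<inter> orbit_hull P2 m"
      using orbit_hull_mono[of "\<lambda>g. P1 g \<and> P2 g" P1 m] orbit_hull_mono[of "\<lambda>g. P1 g \<and> P2 g" P2 m] by blast
    ultimately show "\<exists>D''\<in>?D. D'' \<subseteq> D1 \<inter> D2"
      unfolding P(3,4) by (intro bexI[of _ "D \<inter> orbit_hull (\<lambda>g. P1 g \<and> P2 g) m"]) auto
  next
    show "weakly_closed_convex D'" if "D' \<in> ?D" for D'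
      using that D weakly_closed_convex_orbit_hull weakly_closed_convex_Int by blast
    show "{} \<notin> ?D" using meets by blast
    show "D \<inter> orbit_hull (\<lambda>_. True) m \<in> ?D" by simp
    show "norm x \<le> \<bar>K\<bar> * norm m" if "x \<in> D \<inter> orbit_hull (\<lambda>_. True) m" for x
      using that norm_orbit_hull by blast
  qed
  moreover have "\<Inter>?D \<subseteq> D \<inter> limit_hull m"
    unfolding limit_hull_def using eventually_True[of F] by fastforce
  ultimately show ?thesis by blast
qed

definition invariant_near :: "'m \<Rightarrow> 'm set \<Rightarrow> bool"
  where "invariant_near m D \<longleftrightarrow> weakly_closed_convex D \<and> (\<exists>R. \<forall>x\<in>D. norm x \<le> R) \<and>
    (\<forall>g\<in>A. \<forall>x\<in>D. act g x \<in> D) \<and> D \<inter> limit_hull m \<noteq> {}"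

lemma minimal_invariant_near:
  obtains D where "invariant_near m D" "\<And>D'. invariant_near m D' \<Longrightarrow> D' \<subseteq> D \<Longrightarrow> D' = D"
proof -
  have "\<exists>D\<in>Collect (invariant_near m). \<forall>D'\<in>Collect (invariant_near m). D' \<subseteq> D \<longrightarrow> D' = D"
  proof (rule predicate_Zorn)
    show "partial_order_on (Collect (invariant_near m)) (relation_of (\<lambda>D D'. D' \<subseteq> D) (Collect (invariant_near m)))"
      by (rule partial_order_on_relation_ofI) auto
    fix \<C> assume "\<C> \<in> Chains (relation_of (\<lambda>D D'. D' \<subseteq> D) (Collect (invariant_near m)))"
    then have inv: "\<And>D. D \<in> \<C> \<Longrightarrow> invariant_near m D"
      and chain: "\<And>D D'. D \<in> \<C> \<Longrightarrow> D' \<in> \<C> \<Longrightarrow> D \<subseteq> D' \<or> D' \<subseteq> D"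
      unfolding Chains_def relation_of_def by auto
    show "\<exists>U\<in>Collect (invariant_near m). \<forall>D\<in>\<C>. U \<subseteq> D"
    proof (cases "\<C> = {}")
      case True
      \<comment> \<open>the hull of the whole orbit starts the descent\<close>
      let ?U = "orbit_hull (\<lambda>_. True) m"
      have "act g x \<in> ?U" if g: "g \<in> A" and x: "x \<in> ?U" for g x
      proof -
        have "act g ` {act h m | h. h \<in> A \<and> True} \<subseteq> {act h m | h. h \<in> A \<and> True}"
        proof clarify
          fix h assume "h \<in> A"
          then obtain k where "k \<in> A" "act k m = act g (act h m)"
            using act_mult[OF g] by blast
          then show "\<exists>k. act g (act h m) = act k m \<and> k \<in> A \<and> True" by metis
        qed
        then show ?thesis
          using act_weak_hull[OF g] x weak_hull_mono unfolding orbit_hull_def by blast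
      qed
      moreover have "?U \<inter> limit_hull m \<noteq> {}"
      proof (rule meets_limit_hull[OF weakly_closed_convex_orbit_hull])
        fix P assume "eventually P F"
        then show "?U \<inter> orbit_hull P m \<noteq> {}"
          using orbit_hull_nonempty[of P m] orbit_hull_mono[of P "\<lambda>_. True" m] by blast
      qed
      ultimately have "invariant_near m ?U"
        unfolding invariant_near_def using weakly_closed_convex_orbit_hull norm_orbit_hull by blast
      with True show ?thesis by blast
    next
      case False
      then obtain D0 where D0: "D0 \<in> \<C>" by blast
      then obtain R where R: "\<And>x. x \<in> D0 \<Longrightarrow> norm x \<le> R"
        using inv unfolding invariant_near_def by blast
      have "\<Inter>((\<lambda>D. D \<inter> limit_hull m) ` \<C>) \<noteq> {}"
      proof (rule directed_Inter_nonempty)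
        fix D1 D2 assume "D1 \<in> (\<lambda>D. D \<inter> limit_hull m) ` \<C>" "D2 \<in> (\<lambda>D. D \<inter> limit_hull m) ` \<C>"
        then obtain C1 C2 where C: "C1 \<in> \<C>" "C2 \<in> \<C>"
          and D12: "D1 = C1 \<inter> limit_hull m" "D2 = C2 \<inter> limit_hull m"
          by (elim imageE)
        show "\<exists>D''\<in>(\<lambda>D. D \<inter> limit_hull m) ` \<C>. D'' \<subseteq> D1 \<inter> D2"
        proof (cases "C1 \<subseteq> C2")
          case True
          then have "D1 \<subseteq> D1 \<inter> D2" unfolding D12 by blast
          then show ?thesis unfolding D12 using C(1) by blast
        next
          case False
          then have "D2 \<subseteq> D1 \<inter> D2" unfolding D12 using chain[OF C] by blast
          then show ?thesis unfolding D12 using C(2) by blast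
        qed
      next
        show "weakly_closed_convex D" if "D \<in> (\<lambda>D. D \<inter> limit_hull m) ` \<C>" for D
          using that inv weakly_closed_convex_limit_hull weakly_closed_convex_Int unfolding invariant_near_def by blast
        show "{} \<notin> (\<lambda>D. D \<inter> limit_hull m) ` \<C>"
          using inv unfolding invariant_near_def by blast
        show "D0 \<inter> limit_hull m \<in> (\<lambda>D. D \<inter> limit_hull m) ` \<C>"
          using D0 by blast
        show "norm x \<le> R" if "x \<in> D0 \<inter> limit_hull m" for x
          using that R by blast
      qed
      then have "\<Inter>\<C> \<inter> limit_hull m \<noteq> {}"
        using False by blast
      moreover have "weakly_closed_convex (\<Inter>\<C>)"
        by (rule weakly_closed_convex_Inter) (use inv in \<open>auto simp: invariant_near_def\<close>)
      moreover have "act g x \<in> \<Inter>\<C>" if "g \<in> A" "x \<in> \<Inter>\<C>" for g x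
        using that inv unfolding invariant_near_def by blast
      moreover have "norm x \<le> R" if "x \<in> \<Inter>\<C>" for x
        using that R D0 by blast
      ultimately have "invariant_near m (\<Inter>\<C>)"
        unfolding invariant_near_def by blast
      then show ?thesis by blast
    qed
  qed
  with that show thesis by blast
qed

text \<open>
  The slice that \<open>small_slice\<close> provides may be far from \<open>c\<close>. But removing all its translates leaves an
  invariant set, which by minimality misses the limit hull, so that some translate of the slice
  contains \<open>c\<close>. The translates are small uniformly since the action is bounded.
\<close>

lemma minimal_small_slices:
  assumes D: "invariant_near m D" and min: "\<And>D'. invariant_near m D' \<Longrightarrow> D' \<subseteq> D \<Longrightarrow> D' = D"
    and c: "c \<in> D" "c \<in> limit_hull m" and \<epsilon>: "0 < \<epsilon>"
  obtains e \<alpha> where "\<alpha> < B e c" "\<And>x. x \<in> D \<Longrightarrow> \<alpha> < B e x \<Longrightarrow> norm (x - c) \<le> \<epsilon>"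
proof -
  obtain R where R: "\<And>x. x \<in> D \<Longrightarrow> norm x \<le> R"
    using D unfolding invariant_near_def by blast
  have wcc: "weakly_closed_convex D" and inv: "\<And>g x. g \<in> A \<Longrightarrow> x \<in> D \<Longrightarrow> act g x \<in> D"
    using D unfolding invariant_near_def by blast+
  define \<eta> where "\<eta> = \<epsilon> / (\<bar>K\<bar> + 1)"
  have \<eta>: "0 < \<eta>" "\<bar>K\<bar> * \<eta> \<le> \<epsilon>"
    using \<epsilon> by (auto simp: \<eta>_def field_simps)
  have "D \<noteq> {}" using c by blast
  obtain e \<alpha> where slice: "\<exists>x\<in>D. \<alpha> < B e x"
    "\<And>x x'. x \<in> D \<Longrightarrow> x' \<in> D \<Longrightarrow> \<alpha> < B e x \<Longrightarrow> \<alpha> < B e x' \<Longrightarrow> norm (x - x') \<le> \<eta>"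
    by (rule small_slice[OF wcc \<open>D \<noteq> {}\<close> R \<eta>(1)]) (assumption, rule that, assumption, blast)
  \<comment> \<open>the set \<open>D\<close> without the translates of the slice\<close>
  define D' where "D' = D \<inter> \<Inter>((\<lambda>g. {x. B (coact g e) x \<le> \<alpha>}) ` A)"
  have D'_iff: "x \<in> D' \<longleftrightarrow> x \<in> D \<and> (\<forall>g\<in>A. B e (act g x) \<le> \<alpha>)" for x
    unfolding D'_def by (auto simp: adjoint)
  have "D' \<noteq> D"
    using slice(1) act_one D'_iff by (metis not_le)
  then have "\<not> invariant_near m D'"
    using min[of D'] unfolding D'_def by blast
  moreover have "weakly_closed_convex D'"
    unfolding D'_def
    by (rule weakly_closed_convex_Int[OF wcc weakly_closed_convex_Inter])
      (use weakly_closed_convex_le in blast)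
  moreover have "act g x \<in> D'" if "g \<in> A" "x \<in> D'" for g x
    unfolding D'_iff
  proof (intro conjI ballI)
    show "act g x \<in> D" using that inv D'_iff by blast
    fix h assume "h \<in> A"
    then obtain k where "k \<in> A" "act k x = act h (act g x)"
      using act_mult \<open>g \<in> A\<close> by blast
    then show "B e (act h (act g x)) \<le> \<alpha>"
      using that(2) D'_iff by metis
  qed
  moreover have "\<exists>R. \<forall>x\<in>D'. norm x \<le> R"
    using R D'_iff by blast
  ultimately have "D' \<inter> limit_hull m = {}"
    unfolding invariant_near_def by blast
  with c have "c \<notin> D'" by blast
  with c obtain g where g: "g \<in> A" "\<alpha> < B e (act g c)"
    using D'_iff not_le by blast
  show thesis
  proof
    show "\<alpha> < B (coact g e) c"
      using g by (simp add: adjoint)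
    fix x assume x: "x \<in> D" "\<alpha> < B (coact g e) x"
    obtain h where h: "h \<in> A" "\<And>x. act h (act g x) = x"
      using act_inverse[OF g(1)] by blast
    have "norm (x - c) = norm (act h (act g x) - act h (act g c))"
      using h(2) by simp
    also have "\<dots> \<le> K * norm (act g x - act g c)"
      by (rule act_dist[OF h(1)])
    also have "\<dots> \<le> \<bar>K\<bar> * \<eta>"
      using slice(2)[of "act g x" "act g c"] inv g x c adjoint[OF g(1)]
      by (intro mult_mono) auto
    finally show "norm (x - c) \<le> \<epsilon>"
      using \<eta>(2) by simp
  qed
qed

text \<open>
  A point in arbitrarily small slices of a convex set is not the midpoint of two other points, so the
  minimal set meets the limit hull in one point \<open>c\<close>. Points \<open>act g c\<close> with \<open>g\<close> close to the identity
  lie in the minimal set and, by the multiplicativity of \<open>F\<close>, in the orbit hulls that shrink to the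
  limit hull; hence they can only be in the small slices at \<open>c\<close>.
\<close>

theorem limit_hull_continuity_point:
  obtains c where "c \<in> limit_hull m" "((\<lambda>g. act g c) \<longlongrightarrow> c) F"
proof -
  obtain D where D: "invariant_near m D" and min: "\<And>D'. invariant_near m D' \<Longrightarrow> D' \<subseteq> D \<Longrightarrow> D' = D"
    using minimal_invariant_near by blast
  have wcc: "weakly_closed_convex D" and inv: "\<And>g x. g \<in> A \<Longrightarrow> x \<in> D \<Longrightarrow> act g x \<in> D"
    using D unfolding invariant_near_def by blast+
  obtain c where c: "c \<in> D" "c \<in> limit_hull m"
    using D unfolding invariant_near_def by blast
  have unique: "c' = c" if c': "c' \<in> D" "c' \<in> limit_hull m" for c'
  proof (rule ccontr)
    assume ne: "c' \<noteq> c"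
    let ?d = "(1/2) *\<^sub>R (c' + c)"
    have "?d \<in> D" "?d \<in> limit_hull m"
      using c c' wcc weakly_closed_convex_limit_hull by (auto intro: weakly_closed_convex_midpoint)
    then obtain e \<alpha> where e: "\<alpha> < B e ?d" "\<And>x. x \<in> D \<Longrightarrow> \<alpha> < B e x \<Longrightarrow> norm (x - ?d) \<le> norm (c' - c) / 4"
      using minimal_small_slices[OF D min, of ?d "norm (c' - c) / 4"] ne
      by (metis diff_self zero_less_divide_iff zero_less_norm_iff right_minus_eq zero_less_numeral)
    have "B e ?d = (B e c' + B e c) / 2"
      by (simp add: scaleR_right add_right)
    then have "\<alpha> < (B e c' + B e c) / 2"
      using e(1) by simp
    then have "\<alpha> < B e c' \<or> \<alpha> < B e c"
      by argo
    then have "norm (c' - ?d) \<le> norm (c' - c) / 4 \<or> norm (c - ?d) \<le> norm (c' - c) / 4"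
      using e(2) c c' by blast
    moreover have "c' - ?d = (1/2) *\<^sub>R (c' - c)"
      by (simp add: algebra_simps flip: scaleR_add_left)
    moreover have "c - ?d = - (1/2) *\<^sub>R (c' - c)"
      by (simp add: algebra_simps flip: scaleR_add_left)
    ultimately have "norm (c' - c) / 2 \<le> norm (c' - c) / 4"
      by (auto simp: norm_minus_commute)
    with ne show False by simp
  qed
  have "((\<lambda>g. act g c) \<longlongrightarrow> c) F"
  proof (rule tendstoI)
    fix \<epsilon> :: real assume \<epsilon>: "0 < \<epsilon>"
    obtain e \<alpha> where e: "\<alpha> < B e c" "\<And>x. x \<in> D \<Longrightarrow> \<alpha> < B e x \<Longrightarrow> norm (x - c) \<le> \<epsilon> / 2"
      by (rule minimal_small_slices[OF D min c, of "\<epsilon> / 2"]) (use \<epsilon> in auto)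
    have "weakly_closed_convex (D \<inter> {x. B e x \<le> \<alpha>})"
      using wcc weakly_closed_convex_le weakly_closed_convex_Int by blast
    moreover have "(D \<inter> {x. B e x \<le> \<alpha>}) \<inter> limit_hull m = {}"
      using unique e(1) by fastforce
    ultimately obtain P where P: "eventually P F" "(D \<inter> {x. B e x \<le> \<alpha>}) \<inter> orbit_hull P m = {}"
      using meets_limit_hull by blast
    obtain Q where Q: "eventually Q F"
      "\<forall>g\<in>A. \<forall>h\<in>A. Q g \<longrightarrow> Q h \<longrightarrow> (\<exists>k\<in>A. P k \<and> (\<forall>m. act k m = act g (act h m)))"
      using F_mult[OF P(1)] by blast
    have "eventually (\<lambda>g. g \<in> A \<and> Q g) F"
      using F_carrier Q(1) by (rule eventually_conj)
    then show "eventually (\<lambda>g. dist (act g c) c < \<epsilon>) F"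
    proof (rule eventually_mono)
      fix g assume g: "g \<in> A \<and> Q g"
      have "act g c \<in> weak_hull (act g ` {act h m | h. h \<in> A \<and> Q h})"
        using act_weak_hull g c(2) limit_hull_subset_orbit_hull[OF Q(1)] unfolding orbit_hull_def by blast
      moreover have "act g ` {act h m | h. h \<in> A \<and> Q h} \<subseteq> {act k m | k. k \<in> A \<and> P k}"
      proof clarify
        fix h assume "h \<in> A" "Q h"
        then obtain k where "k \<in> A" "P k" "act k m = act g (act h m)"
          using Q(2) g by blast
        then show "\<exists>k. act g (act h m) = act k m \<and> k \<in> A \<and> P k" by metis
      qed
      ultimately have "act g c \<in> orbit_hull P m"
        unfolding orbit_hull_def using weak_hull_mono by blast
      then have "\<not> B e (act g c) \<le> \<alpha>"
        using P(2) inv c(1) g by blast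
      then have "norm (act g c - c) \<le> \<epsilon> / 2"
        using e(2) inv c(1) g by auto
      then show "dist (act g c) c < \<epsilon>"
        using \<epsilon> by (simp add: dist_norm)
    qed
  qed
  with c that show thesis by blast
qed

lemma limit_hull_eval:
  assumes c: "c \<in> limit_hull m" and lim: "((\<lambda>g. B e (act g m)) \<longlongrightarrow> l) F"
  shows "B e c = l"
proof -
  have near: "B e c \<le> l + \<epsilon> \<and> l \<le> B e c + \<epsilon>" if \<epsilon>: "0 < \<epsilon>" for \<epsilon>
  proof -
    let ?P = "\<lambda>g. \<bar>B e (act g m) - l\<bar> < \<epsilon>"
    have "eventually ?P F"
      using tendstoD[OF lim \<epsilon>] by (simp add: dist_real_def)
    then have c': "c \<in> weak_hull {act g m | g. g \<in> A \<and> ?P g}"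
      using limit_hull_subset_orbit_hull c unfolding orbit_hull_def by blast
    have "B e c \<le> l + \<epsilon>"
      by (rule weak_hullD[OF c']) auto
    moreover have "B (- e) c \<le> \<epsilon> - l"
      by (rule weak_hullD[OF c']) (auto simp: minus_left)
    ultimately show ?thesis
      by (simp add: minus_left)
  qed
  show ?thesis
  proof (rule antisym)
    show "B e c \<le> l" by (rule field_le_epsilon) (use near in blast)
    show "l \<le> B e c" by (rule field_le_epsilon) (use near in blast)
  qed
qed

end

section \<open>Real reflexivity and separability of the dual\<close>

text \<open>
  The norm of \<open>'k\<close> is multiplicative and determines the inner product by polarization. Therefore
  \<open>c \<mapsto> c \<bullet> 1\<close> behaves like the real part, for all admissible scalar fields at once.
\<close>

lemma inner_mult_right:
  fixes a c d :: "'k::{real_normed_field,euclidean_space}"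
  shows "(c * a) \<bullet> (d * a) = (norm a)\<^sup>2 * (c \<bullet> d)"
proof -
  have "norm (c * a + d * a) = norm (c + d) * norm a"
    by (simp add: norm_mult flip: distrib_right)
  then show ?thesis
    by (simp add: dot_norm norm_mult power_mult_distrib algebra_simps diff_divide_distrib)
qed

lemma real_part_nondegenerate:
  fixes k :: "'k::{real_normed_field,euclidean_space}"
  assumes "\<And>c. (c * k) \<bullet> 1 = 0"
  shows "k = 0"
  using assms[of "inverse k"] by (cases "k = 0") auto

lemma real_part_representation:
  fixes l :: "'k::{real_normed_field,euclidean_space} \<Rightarrow> real"
  assumes l: "linear l"
  shows "\<exists>k. \<forall>c. l c = (c * k) \<bullet> 1"
proof -
  define h where "h = adjoint l 1"
  have lh: "l c = c \<bullet> h" for c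
    using adjoint_works[OF l, of c 1] by (simp add: h_def)
  show ?thesis
  proof (cases "h = 0")
    case True
    then show ?thesis using lh by (intro exI[of _ 0]) simp
  next
    case False
    have "l c = (c * ((norm h)\<^sup>2 *\<^sub>R inverse h)) \<bullet> 1" for c
    proof -
      have "(c * inverse h) \<bullet> (h * inverse h) = (norm (inverse h))\<^sup>2 * (c \<bullet> h)"
        by (rule inner_mult_right)
      then have "(c * inverse h) \<bullet> 1 = (c \<bullet> h) / (norm h)\<^sup>2"
        using False by (simp add: norm_inverse power_inverse divide_inverse)
      then show ?thesis
        using False lh by simp
    qed
    then show ?thesis by blast
  qed
qed

text \<open>
  The scalar \<open>k\<close> for which the given real linear form is \<open>c \<mapsto> Re (c * k)\<close>.
\<close>

definition real_part_rep :: "('k::{real_normed_field,euclidean_space} \<Rightarrow> real) \<Rightarrow> 'k"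
  where "real_part_rep l = (SOME k. \<forall>c. l c = (c * k) \<bullet> 1)"

lemma real_part_rep: "linear l \<Longrightarrow> l c = (c * real_part_rep l) \<bullet> 1"
  using someI_ex[OF real_part_representation] unfolding real_part_rep_def by blast

lemma real_part_rep_unique:
  assumes "\<And>c. l c = (c * k) \<bullet> 1"
  shows "real_part_rep l = k"
proof -
  have "\<forall>c. l c = (c * real_part_rep l) \<bullet> 1"
    unfolding real_part_rep_def by (rule someI) (use assms in blast)
  then have "(c * (real_part_rep l - k)) \<bullet> 1 = 0" for c
    using assms by (simp add: right_diff_distrib inner_diff_left)
  then show ?thesis
    using real_part_nondegenerate by fastforce
qed

lemma norm_real_part_rep_le:
  fixes l :: "'k::{real_normed_field,euclidean_space} \<Rightarrow> real"
  assumes l: "linear l" and C: "\<And>c. l c \<le> C * norm c"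
  shows "norm (real_part_rep l) \<le> C"
proof (cases "real_part_rep l = 0")
  case True
  have "0 \<le> C"
    using C[of 0] C[of 1] C[of "-1"] linear_neg[OF l, of 1] by simp
  with True show ?thesis by simp
next
  case False
  have "1 = l (inverse (real_part_rep l))"
    using real_part_rep[OF l, of "inverse (real_part_rep l)"] False power2_norm_eq_inner[of "1::'k"]
    by simp
  also have "\<dots> \<le> C * norm (inverse (real_part_rep l))"
    by (rule C)
  finally have "1 \<le> C / norm (real_part_rep l)"
    by (simp add: norm_inverse divide_inverse)
  with False show ?thesis
    by (simp add: pos_le_divide_eq)
qed

context banach_over
begin

lemma real_part_bounded_linear:
  assumes "f \<in> dual_space scl"
  shows "bounded_linear (\<lambda>x. (c * f x) \<bullet> 1)"
proof -
  have "bounded_linear f"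
    using assms unfolding dual_space_def by blast
  then show ?thesis
    by (intro bounded_linear_inner_left_comp bounded_linear_const_mult)
qed

text \<open>
  The functional over \<open>'k\<close> with real part \<open>g\<close>; over the complex numbers it is \<open>x \<mapsto> g x - i * g (i * x)\<close>.
\<close>

definition scalar_extension :: "('a \<Rightarrow>\<^sub>L real) \<Rightarrow> 'a \<Rightarrow> 'k"
  where "scalar_extension g x = real_part_rep (\<lambda>c. blinfun_apply g (scl c x))"

lemma linear_orbit_functional: "linear (\<lambda>c. blinfun_apply g (scl c x))"
proof (rule linearI)
  show "g (scl (c + d) x) = g (scl c x) + g (scl d x)" for c d
    by (simp add: scale_left_distrib blinfun.add_right)
  show "g (scl (r *\<^sub>R c) x) = r *\<^sub>R g (scl c x)" for r c
  proof -
    have "scl (r *\<^sub>R c) x = r *\<^sub>R scl c x"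
      by (simp add: scaleR_conv_of_real scale_of_real flip: scale_scale)
    then show ?thesis by (simp add: blinfun.scaleR_right)
  qed
qed

lemma scalar_extension: "blinfun_apply g (scl c x) = (c * scalar_extension g x) \<bullet> 1"
  unfolding scalar_extension_def by (rule real_part_rep[OF linear_orbit_functional])

lemma scalar_extension_in_dual: "scalar_extension g \<in> dual_space scl"
proof -
  have add: "scalar_extension g (x + y) = scalar_extension g x + scalar_extension g y" for x y
    unfolding scalar_extension_def[of g "x + y"]
    by (rule real_part_rep_unique)
      (simp add: scale_right_distrib blinfun.add_right scalar_extension inner_add_left distrib_left)
  have scale: "scalar_extension g (scl d x) = d * scalar_extension g x" for d x
    unfolding scalar_extension_def[of g "scl d x"]
    by (rule real_part_rep_unique) (simp add: scalar_extension mult.assoc)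
  have norm: "norm (scalar_extension g x) \<le> norm x * norm g" for x
    unfolding scalar_extension_def
  proof (rule norm_real_part_rep_le[OF linear_orbit_functional])
    fix c
    have "g (scl c x) \<le> norm g * norm (scl c x)"
      using norm_blinfun[of g "scl c x"] by simp
    then show "g (scl c x) \<le> norm x * norm g * norm c"
      by (simp add: norm_scale mult.commute mult.left_commute)
  qed
  have "bounded_linear (scalar_extension g)"
  proof (rule bounded_linear_intro[OF add _ norm])
    show "scalar_extension g (r *\<^sub>R x) = r *\<^sub>R scalar_extension g x" for r x
      using scale[of "of_real r" x] by (simp add: scale_of_real scaleR_conv_of_real)
  qed
  moreover have "Vector_Spaces.linear scl (*) (scalar_extension g)"
    by unfold_locales (auto simp: add scale algebra_simps)
  ultimately show ?thesis
    unfolding dual_space_def by blast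
qed

text \<open>
  Taking real parts identifies the dual over \<open>'k\<close> with the real dual, and \<open>scalar_extension\<close> is the
  inverse of this identification. A real functional \<open>\<phi>\<close> on the real dual thus gives a functional \<open>F\<close>
  over \<open>'k\<close> on the dual over \<open>'k\<close>, and the point that represents \<open>F\<close> represents \<open>\<phi>\<close>.
\<close>

lemma real_reflexive:
  assumes refl: "reflexive_space scl"
    and \<phi>: "bounded_linear (\<phi> :: ('a \<Rightarrow>\<^sub>L real) \<Rightarrow> real)"
  shows "\<exists>x. \<forall>g. \<phi> g = blinfun_apply g x"
proof -
  interpret \<phi>: bounded_linear \<phi> by (rule \<phi>)
  define re where "re f c = Blinfun (\<lambda>x. (c * f x) \<bullet> 1)" for f :: "'a \<Rightarrow> 'k" and c
  define F where "F f = real_part_rep (\<lambda>c. \<phi> (re f c))" for f :: "'a \<Rightarrow> 'k"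
  have re_apply: "blinfun_apply (re f c) x = (c * f x) \<bullet> 1" if "f \<in> dual_space scl" for f c x
    by (simp add: re_def bounded_linear_Blinfun_apply[OF real_part_bounded_linear[OF that]])
  have lin: "linear (\<lambda>c. \<phi> (re f c))" if f: "f \<in> dual_space scl" for f
  proof (rule linearI)
    show "\<phi> (re f (c + d)) = \<phi> (re f c) + \<phi> (re f d)" for c d
      unfolding \<phi>.add[symmetric]
      by (intro arg_cong[of _ _ \<phi>] blinfun_eqI)
        (simp add: re_apply[OF f] blinfun.add_left inner_add_left distrib_right)
    show "\<phi> (re f (r *\<^sub>R c)) = r *\<^sub>R \<phi> (re f c)" for r c
      unfolding \<phi>.scaleR[symmetric]
      by (intro arg_cong[of _ _ \<phi>] blinfun_eqI) (simp add: re_apply[OF f] blinfun.scaleR_left)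
  qed
  have F: "\<phi> (re f c) = (c * F f) \<bullet> 1" if "f \<in> dual_space scl" for f c
    unfolding F_def by (rule real_part_rep[OF lin[OF that]])
  have dual_add: "(\<lambda>x. f x + g x) \<in> dual_space scl" if "f \<in> dual_space scl" "g \<in> dual_space scl" for f g
    using that unfolding dual_space_def unfolding Vector_Spaces.linear_iff
    by (auto intro: bounded_linear_add simp: algebra_simps)
  have dual_scale: "(\<lambda>x. c * f x) \<in> dual_space scl" if "f \<in> dual_space scl" for f c
    using that unfolding dual_space_def Vector_Spaces.linear_iff
    by (auto intro: bounded_linear_const_mult simp: algebra_simps)
  have "F \<in> bidual_space scl"
    unfolding bidual_space_def
  proof (intro CollectI conjI ballI allI exI)
    fix f g assume f: "f \<in> dual_space scl" and g: "g \<in> dual_space scl"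
    show "F (\<lambda>x. f x + g x) = F f + F g"
      unfolding F_def[of "\<lambda>x. f x + g x"]
    proof (rule real_part_rep_unique)
      fix c
      have "re (\<lambda>x. f x + g x) c = re f c + re g c"
        by (rule blinfun_eqI)
          (simp add: re_apply f g dual_add blinfun.add_left inner_add_left distrib_left)
      then show "\<phi> (re (\<lambda>x. f x + g x) c) = (c * (F f + F g)) \<bullet> 1"
        by (simp add: \<phi>.add F f g distrib_left inner_add_left)
    qed
  next
    fix d f assume f: "f \<in> dual_space scl"
    show "F (\<lambda>x. d * f x) = d * F f"
      unfolding F_def[of "\<lambda>x. d * f x"]
    proof (rule real_part_rep_unique)
      fix c
      have "re (\<lambda>x. d * f x) c = re f (c * d)"
        by (rule blinfun_eqI) (simp add: re_apply f dual_scale mult.assoc)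
      then show "\<phi> (re (\<lambda>x. d * f x) c) = (c * (d * F f)) \<bullet> 1"
        by (simp add: F f mult.assoc)
    qed
  next
    fix f assume f: "f \<in> dual_space scl"
    then have bf: "bounded_linear f" unfolding dual_space_def by blast
    show "norm (F f) \<le> onorm \<phi> * onorm f"
      unfolding F_def
    proof (rule norm_real_part_rep_le[OF lin[OF f]])
      fix c
      have "norm (re f c) \<le> norm c * onorm f"
      proof (rule norm_blinfun_bound)
        show "0 \<le> norm c * onorm f" using onorm_pos_le[OF bf] by simp
        fix x
        have "\<bar>(c * f x) \<bullet> 1\<bar> \<le> norm (c * f x) * norm (1 :: 'k)"
          by (rule Cauchy_Schwarz_ineq2)
        also have "\<dots> \<le> norm c * (onorm f * norm x)"
          using onorm[OF bf, of x] by (simp add: norm_mult mult_left_mono)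
        finally show "norm (blinfun_apply (re f c) x) \<le> norm c * onorm f * norm x"
          by (simp add: re_apply[OF f] mult.assoc)
      qed
      then have "onorm \<phi> * norm (re f c) \<le> onorm \<phi> * (norm c * onorm f)"
        using onorm_pos_le[OF \<phi>] by (rule mult_left_mono)
      moreover have "\<phi> (re f c) \<le> onorm \<phi> * norm (re f c)"
        using onorm[OF \<phi>, of "re f c"] by simp
      ultimately show "\<phi> (re f c) \<le> onorm \<phi> * onorm f * norm c"
        by (simp add: mult.commute mult.left_commute)
    qed
  qed
  with refl obtain x where x: "\<And>f. f \<in> dual_space scl \<Longrightarrow> F f = f x"
    unfolding reflexive_space_def by blast
  have "\<phi> g = g x" for g
  proof -
    let ?f = "scalar_extension g"
    have f: "?f \<in> dual_space scl" by (rule scalar_extension_in_dual)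
    have val: "?f y \<bullet> 1 = g y" for y
      using scalar_extension[of g 1 y] by simp
    have "re ?f 1 = g"
      by (rule blinfun_eqI) (simp add: re_apply[OF f] val)
    then have "\<phi> g = F ?f \<bullet> 1"
      using F[OF f, of 1] by simp
    then show ?thesis
      using x[OF f] val by simp
  qed
  then show ?thesis by blast
qed

end

definition rational_combinations :: "'b::real_vector set \<Rightarrow> 'b set"
  where "rational_combinations S = (\<lambda>l. \<Sum>(r, v)\<leftarrow>l. of_rat r *\<^sub>R v) ` lists (UNIV \<times> S)"

lemma countable_rational_combinations: "countable S \<Longrightarrow> countable (rational_combinations S)"
  unfolding rational_combinations_def by (intro countable_image countable_lists countable_SIGMA) auto

lemma rational_combinations_add:
  assumes "x \<in> rational_combinations S" "y \<in> rational_combinations S"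
  shows "x + y \<in> rational_combinations S"
proof -
  obtain k l where "k \<in> lists (UNIV \<times> S)" "l \<in> lists (UNIV \<times> S)"
    "x = (\<Sum>(r, v)\<leftarrow>k. of_rat r *\<^sub>R v)" "y = (\<Sum>(r, v)\<leftarrow>l. of_rat r *\<^sub>R v)"
    using assms unfolding rational_combinations_def by blast
  then show ?thesis
    unfolding rational_combinations_def by (intro image_eqI[of _ _ "k @ l"]) auto
qed

lemma rational_combinations_scale:
  assumes "x \<in> rational_combinations S"
  shows "of_rat q *\<^sub>R x \<in> rational_combinations S"
proof -
  obtain l where l: "l \<in> lists (UNIV \<times> S)" "x = (\<Sum>(r, v)\<leftarrow>l. of_rat r *\<^sub>R v)"
    using assms unfolding rational_combinations_def by blast
  have "of_rat q *\<^sub>R (\<Sum>(r, v)\<leftarrow>l. of_rat r *\<^sub>R v) = (\<Sum>(r, v)\<leftarrow>map (\<lambda>(r, v). (q * r, v)) l. of_rat r *\<^sub>R v)"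
    by (induction l) (auto simp: scaleR_add_right of_rat_mult)
  moreover have "map (\<lambda>(r, v). (q * r, v)) l \<in> lists (UNIV \<times> S)"
    using l(1) by auto
  ultimately show ?thesis
    unfolding rational_combinations_def l(2) by (intro image_eqI)
qed

lemma subspace_closure_rational_combinations:
  fixes S :: "'b::real_normed_vector set"
  shows "subspace (closure (rational_combinations S))"
proof (rule subspaceI)
  let ?C = "rational_combinations S"
  have "0 \<in> ?C"
    unfolding rational_combinations_def by (intro image_eqI[of _ _ "[]"]) auto
  then show "0 \<in> closure ?C" using closure_subset by blast
  show "x + y \<in> closure ?C" if xy: "x \<in> closure ?C" "y \<in> closure ?C" for x y
  proof -
    obtain X Y where X: "\<And>n::nat. X n \<in> ?C" "X \<longlonglongrightarrow> x" and Y: "\<And>n::nat. Y n \<in> ?C" "Y \<longlonglongrightarrow> y"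
      using xy unfolding closure_sequential by metis
    have "\<forall>n. X n + Y n \<in> ?C" using X(1) Y(1) rational_combinations_add by blast
    moreover have "(\<lambda>n. X n + Y n) \<longlonglongrightarrow> x + y"
      using X(2) Y(2) by (rule tendsto_add)
    ultimately show ?thesis unfolding closure_sequential by (intro exI[of _ "\<lambda>n. X n + Y n"]) blast
  qed
  show "c *\<^sub>R x \<in> closure ?C" if x: "x \<in> closure ?C" for c x
  proof -
    obtain X where X: "\<And>n::nat. X n \<in> ?C" "X \<longlonglongrightarrow> x"
      using x unfolding closure_sequential by metis
    have "c \<in> closure \<rat>" by (simp add: Rats_closure_real)
    then obtain q where q: "\<And>n::nat. q n \<in> \<rat>" "q \<longlonglongrightarrow> c"
      unfolding closure_sequential by metis
    have "q n *\<^sub>R X n \<in> ?C" for n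
      using q(1)[of n] rational_combinations_scale[OF X(1)[of n]] by (auto elim: Rats_cases)
    moreover have "(\<lambda>n. q n *\<^sub>R X n) \<longlonglongrightarrow> c *\<^sub>R x"
      using q(2) X(2) by (rule tendsto_scaleR)
    ultimately show ?thesis unfolding closure_sequential by (intro exI[of _ "\<lambda>n. q n *\<^sub>R X n"]) blast
  qed
qed

lemma rational_combinations_superset: "S \<subseteq> rational_combinations S"
proof
  fix v assume "v \<in> S"
  then show "v \<in> rational_combinations S"
    unfolding rational_combinations_def by (intro image_eqI[of _ _ "[(1, v)]"]) auto
qed

text \<open>
  Norming functionals, one for each point of a dense set, span a dense subspace: otherwise
  the Hahn-Banach theorem and reflexivity give a nonzero \<open>x\<close> at which all of them vanish, although one of
  them is large at a point close to \<open>x\<close>.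
\<close>

lemma reflexive_dual_separable:
  fixes Q :: "'a::banach set"
  assumes Q: "countable Q" "closure Q = UNIV"
    and refl: "\<And>\<phi> :: ('a \<Rightarrow>\<^sub>L real) \<Rightarrow> real. bounded_linear \<phi> \<Longrightarrow> \<exists>x. \<forall>g. \<phi> g = blinfun_apply g x"
  shows "\<exists>R :: ('a \<Rightarrow>\<^sub>L real) set. countable R \<and> closure R = UNIV"
proof -
  have "\<exists>g :: 'a \<Rightarrow>\<^sub>L real. norm g \<le> 1 \<and> blinfun_apply g q = norm q" for q
    using norming_functional[of q] by blast
  then obtain g :: "'a \<Rightarrow> 'a \<Rightarrow>\<^sub>L real" where g: "\<And>q. norm (g q) \<le> 1" "\<And>q. blinfun_apply (g q) q = norm q"
    by metis
  let ?R = "rational_combinations (g ` Q)"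
  have "f \<in> closure ?R" for f
  proof (rule ccontr)
    assume "f \<notin> closure ?R"
    then obtain \<Phi> :: "('a \<Rightarrow>\<^sub>L real) \<Rightarrow>\<^sub>L real" where \<Phi>: "\<And>h. h \<in> closure ?R \<Longrightarrow> \<Phi> h = 0" "\<Phi> f \<noteq> 0"
      by (rule separating_functional[OF subspace_closure_rational_combinations closed_closure]) blast
    obtain x where x: "\<And>h. blinfun_apply \<Phi> h = blinfun_apply h x"
      using refl[OF blinfun.bounded_linear_right[of \<Phi>]] by blast
    have "norm x \<le> 0 + \<epsilon>" if \<epsilon>: "0 < \<epsilon>" for \<epsilon>
    proof -
      have "x \<in> closure Q" using Q(2) by simp
      then obtain q where q: "q \<in> Q" "dist q x < \<epsilon> / 2"
        using \<epsilon> unfolding closure_approachable by (metis half_gt_zero)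
      have "g q \<in> closure ?R"
        by (rule subsetD[OF closure_subset subsetD[OF rational_combinations_superset imageI[OF q(1)]]])
      then have "norm q = blinfun_apply (g q) (q - x)"
        using \<Phi>(1) x g(2) by (simp add: blinfun.diff_right)
      also have "\<dots> \<le> norm (g q) * norm (q - x)"
        using norm_blinfun[of "g q" "q - x"] by simp
      also have "\<dots> \<le> norm (q - x)"
        using g(1)[of q] by (simp add: mult_left_le_one_le)
      finally have "norm q \<le> norm (q - x)" .
      moreover have "norm x \<le> norm q + norm (q - x)"
        by (metis norm_minus_commute norm_triangle_sub)
      ultimately show ?thesis
        using q(2) by (simp add: dist_norm)
    qed
    then have "norm x \<le> 0" by (rule field_le_epsilon)
    with \<Phi>(2) x show False by (simp add: blinfun.zero_right)
  qed
  then have "closure ?R = UNIV" by blast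
  moreover have "countable ?R"
    using Q(1) by (intro countable_rational_combinations countable_image)
  ultimately show ?thesis by blast
qed

section \<open>Splitting off the continuous vectors\<close>

text \<open>
  A bounded group of operators on a separable reflexive space with a filter that behaves like the
  neighbourhoods of the identity in some group topology. That topology may be coarser than the strong
  operator topology and need not be Hausdorff, since it is going to be pulled back from a diagonal
  block.
\<close>

locale bounded_operator_filter =
  fixes G :: "('a::banach \<Rightarrow> 'a) set" and K :: real and F :: "('a \<Rightarrow> 'a) filter"
  assumes separable: "\<exists>Q::'a set. countable Q \<and> closure Q = UNIV"
    and reflexive: "bounded_linear (\<phi> :: ('a \<Rightarrow>\<^sub>L real) \<Rightarrow> real) \<Longrightarrow> \<exists>x. \<forall>g. \<phi> g = blinfun_apply g x"
    and operator_bounded_linear: "T \<in> G \<Longrightarrow> bounded_linear T"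
    and bound: "T \<in> G \<Longrightarrow> norm (T x) \<le> K * norm x" and K_nonneg: "0 \<le> K"
    and id_in: "id \<in> G" and comp_in: "S \<in> G \<Longrightarrow> T \<in> G \<Longrightarrow> S \<circ> T \<in> G"
    and inverse_in: "T \<in> G \<Longrightarrow> \<exists>S\<in>G. S \<circ> T = id \<and> T \<circ> S = id"
    and F_nontrivial: "F \<noteq> bot"
    and F_carrier: "eventually (\<lambda>T. T \<in> G) F"
    and F_mult: "eventually P F \<Longrightarrow>
      \<exists>Q. eventually Q F \<and> (\<forall>S\<in>G. \<forall>T\<in>G. Q S \<longrightarrow> Q T \<longrightarrow> P (S \<circ> T))"
    and F_conj: "S \<in> G \<Longrightarrow> S' \<in> G \<Longrightarrow> S \<circ> S' = id \<Longrightarrow> eventually P F \<Longrightarrow> eventually (\<lambda>T. P (S \<circ> T \<circ> S')) F"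
begin

definition continuous_vectors :: "'a set"
  where "continuous_vectors = {x. ((\<lambda>T. T x) \<longlongrightarrow> x) F}"

text \<open>
  Convergence is only required pointwise. This is what a functional vanishing on \<open>Y\<close> satisfies when
  the block at \<open>Z\<close> tends to the identity.
\<close>

definition continuous_functionals :: "('a \<Rightarrow>\<^sub>L real) set"
  where "continuous_functionals = {f. \<forall>x. ((\<lambda>T. blinfun_apply f (T x)) \<longlongrightarrow> blinfun_apply f x) F}"

definition coannihilator :: "'a set"
  where "coannihilator = {x. \<forall>f\<in>continuous_functionals. blinfun_apply f x = 0}"

lemma Blinfun_apply: "T \<in> G \<Longrightarrow> blinfun_apply (Blinfun T) = T"
  by (rule bounded_linear_Blinfun_apply[OF operator_bounded_linear])

lemma norm_Blinfun_le: "T \<in> G \<Longrightarrow> norm (Blinfun T) \<le> K"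
  by (rule norm_blinfun_bound[OF K_nonneg]) (simp add: Blinfun_apply bound)

lemma evaluation_pair: "dual_pair (blinfun_apply :: ('a \<Rightarrow>\<^sub>L real) \<Rightarrow> 'a \<Rightarrow> real)"
proof (intro dual_pair.intro bounded_bilinear_blinfun_apply dual_pair_axioms.intro)
  show "\<bar>blinfun_apply f x\<bar> \<le> norm f * norm x" for f :: "'a \<Rightarrow>\<^sub>L real" and x
    using norm_blinfun[of f x] by simp
  show "norm x \<le> c" if "0 \<le> c" "\<And>f :: 'a \<Rightarrow>\<^sub>L real. \<bar>blinfun_apply f x\<bar> \<le> c * norm f" for c and x :: 'a
  proof -
    obtain f :: "'a \<Rightarrow>\<^sub>L real" where f: "norm f \<le> 1" "f x = norm x"
      by (rule norming_functional)
    have "norm x \<le> c * norm f" using that(2)[of f] f(2) by simp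
    also have "\<dots> \<le> c" using f(1) that(1) by (simp add: mult_left_le)
    finally show ?thesis .
  qed
qed (use reflexive separable in blast)+

lemma coevaluation_pair: "dual_pair (\<lambda>x (f :: 'a \<Rightarrow>\<^sub>L real). blinfun_apply f x)"
proof (intro dual_pair.intro bounded_bilinear.flip[OF bounded_bilinear_blinfun_apply] dual_pair_axioms.intro)
  show "\<bar>blinfun_apply f x\<bar> \<le> norm x * norm f" for f :: "'a \<Rightarrow>\<^sub>L real" and x
    using norm_blinfun[of f x] by (simp add: mult.commute)
  show "norm f \<le> c" if "0 \<le> c" "\<And>x. \<bar>blinfun_apply f x\<bar> \<le> c * norm x" for c and f :: "'a \<Rightarrow>\<^sub>L real"
    by (rule norm_blinfun_bound) (use that in auto)
  show "\<exists>f :: 'a \<Rightarrow>\<^sub>L real. \<forall>x. \<phi> x = f x" if \<phi>: "bounded_linear \<phi>" for \<phi>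
    by (intro exI[of _ "Blinfun \<phi>"]) (simp add: bounded_linear_Blinfun_apply[OF \<phi>])
  show "\<exists>Q :: ('a \<Rightarrow>\<^sub>L real) set. countable Q \<and> closure Q = UNIV"
    using separable reflexive_dual_separable reflexive by blast
qed

lemma action_on_vectors:
  "near_identity_action (blinfun_apply :: ('a \<Rightarrow>\<^sub>L real) \<Rightarrow> 'a \<Rightarrow> real) G (\<lambda>T. T) (\<lambda>T f. f o\<^sub>L Blinfun T) K F"
proof (intro near_identity_action.intro evaluation_pair near_identity_action_axioms.intro)
  show "\<exists>g\<in>G. \<forall>m. g m = m" by (rule bexI[OF _ id_in]) simp
  show "\<exists>h\<in>G. \<forall>m. h (g m) = m" if "g \<in> G" for g
    using inverse_in[OF that] by (metis comp_apply id_apply)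
  show "\<exists>k\<in>G. \<forall>m. k m = g (h m)" if "g \<in> G" "h \<in> G" for g h
    using comp_in[OF that] by (intro bexI[of _ "g \<circ> h"]) auto
  show "\<exists>Q. eventually Q F \<and> (\<forall>g\<in>G. \<forall>h\<in>G. Q g \<longrightarrow> Q h \<longrightarrow> (\<exists>k\<in>G. P k \<and> (\<forall>m. k m = g (h m))))"
    if "eventually P F" for P
    using F_mult[OF that] comp_in by (metis comp_apply)
qed (use bound F_nontrivial F_carrier in \<open>auto simp: Blinfun_apply\<close>)

lemma action_on_functionals:
  "near_identity_action (\<lambda>x (f :: 'a \<Rightarrow>\<^sub>L real). blinfun_apply f x) G (\<lambda>T f. f o\<^sub>L Blinfun T) (\<lambda>T. T) K F"
proof (intro near_identity_action.intro coevaluation_pair near_identity_action_axioms.intro)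
  have comp: "f o\<^sub>L Blinfun (T \<circ> S) = (f o\<^sub>L Blinfun T) o\<^sub>L Blinfun S" if "S \<in> G" "T \<in> G"
    for S T and f :: "'a \<Rightarrow>\<^sub>L real"
    by (rule blinfun_eqI) (simp add: Blinfun_apply that comp_in)
  have one: "f o\<^sub>L Blinfun id = f" for f :: "'a \<Rightarrow>\<^sub>L real"
    by (rule blinfun_eqI) (simp add: Blinfun_apply id_in)
  show "norm (f o\<^sub>L Blinfun T) \<le> K * norm f" if "T \<in> G" for T and f :: "'a \<Rightarrow>\<^sub>L real"
    using norm_blinfun_compose[of f "Blinfun T"] mult_left_mono[OF norm_Blinfun_le[OF that], of "norm f"]
    by (simp add: mult.commute)
  show "\<exists>g\<in>G. \<forall>f :: 'a \<Rightarrow>\<^sub>L real. f o\<^sub>L Blinfun g = f"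
    using id_in one by blast
  show "\<exists>h\<in>G. \<forall>f :: 'a \<Rightarrow>\<^sub>L real. (f o\<^sub>L Blinfun g) o\<^sub>L Blinfun h = f" if g: "g \<in> G" for g
  proof -
    obtain h where "h \<in> G" "g \<circ> h = id" using inverse_in[OF g] by blast
    with g one comp[of h g] show ?thesis by metis
  qed
  show "\<exists>k\<in>G. \<forall>f :: 'a \<Rightarrow>\<^sub>L real. f o\<^sub>L Blinfun k = (f o\<^sub>L Blinfun h) o\<^sub>L Blinfun g" if "g \<in> G" "h \<in> G" for g h
    using comp_in[of h g] comp[of g h] that by blast
  show "\<exists>Q. eventually Q F \<and> (\<forall>g\<in>G. \<forall>h\<in>G. Q g \<longrightarrow> Q h \<longrightarrow>
      (\<exists>k\<in>G. P k \<and> (\<forall>f :: 'a \<Rightarrow>\<^sub>L real. f o\<^sub>L Blinfun k = (f o\<^sub>L Blinfun h) o\<^sub>L Blinfun g)))"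
    if P: "eventually P F" for P
  proof -
    obtain Q where Q: "eventually Q F" "\<forall>S\<in>G. \<forall>T\<in>G. Q S \<longrightarrow> Q T \<longrightarrow> P (S \<circ> T)"
      using F_mult[OF P] by blast
    then show ?thesis
      using comp_in comp by (intro exI[of _ Q]) blast
  qed
qed (use F_nontrivial F_carrier in \<open>auto simp: Blinfun_apply\<close>)

text \<open>
  A continuous functional cannot distinguish \<open>x\<close> from a point in the limit hull of \<open>x\<close>, and this hull
  contains a continuous vector.
\<close>

lemma vector_decomposition:
  obtains w where "w \<in> continuous_vectors" "x - w \<in> coannihilator"
proof -
  interpret near_identity_action "blinfun_apply :: ('a \<Rightarrow>\<^sub>L real) \<Rightarrow> 'a \<Rightarrow> real" G "\<lambda>T. T" "\<lambda>T f. f o\<^sub>L Blinfun T" K F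
    by (rule action_on_vectors)
  obtain w where w: "w \<in> limit_hull x" "((\<lambda>T. T w) \<longlongrightarrow> w) F"
    using limit_hull_continuity_point by blast
  have "blinfun_apply f (x - w) = 0" if f: "f \<in> continuous_functionals" for f
  proof -
    have "blinfun_apply f w = blinfun_apply f x"
      by (rule limit_hull_eval[OF w(1)]) (use f in \<open>auto simp: continuous_functionals_def\<close>)
    then show ?thesis by (simp add: blinfun.diff_right)
  qed
  with w(2) that show thesis
    unfolding continuous_vectors_def coannihilator_def by blast
qed

text \<open>
  The same averaging, applied in the dual, moves a norming functional of \<open>x\<close> to a continuous one. Its
  value at \<open>x\<close> does not change because \<open>x\<close> is a continuous vector.
\<close>

lemma continuous_vectors_Int_coannihilator:
  assumes x: "x \<in> continuous_vectors" "x \<in> coannihilator"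
  shows "x = 0"
proof -
  interpret near_identity_action "\<lambda>x (f :: 'a \<Rightarrow>\<^sub>L real). blinfun_apply f x" G "\<lambda>T f. f o\<^sub>L Blinfun T" "\<lambda>T. T" K F
    by (rule action_on_functionals)
  obtain f :: "'a \<Rightarrow>\<^sub>L real" where f: "f x = norm x"
    by (rule norming_functional)
  obtain h where h: "h \<in> limit_hull f" "((\<lambda>T. h o\<^sub>L Blinfun T) \<longlongrightarrow> h) F"
    using limit_hull_continuity_point by blast
  have "((\<lambda>T. h (T y)) \<longlongrightarrow> h y) F" for y
  proof (rule Lim_transform_eventually)
    show "((\<lambda>T. blinfun_apply (h o\<^sub>L Blinfun T) y) \<longlongrightarrow> h y) F"
      by (intro tendsto_intros h(2))
    show "\<forall>\<^sub>F T in F. blinfun_apply (h o\<^sub>L Blinfun T) y = h (T y)"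
      using F_carrier by (rule eventually_mono) (simp add: Blinfun_apply)
  qed
  then have "h x = 0"
    using x(2) unfolding coannihilator_def continuous_functionals_def by blast
  moreover have "h x = f x"
  proof (rule limit_hull_eval[OF h(1)])
    have "((\<lambda>T. f (T x)) \<longlongrightarrow> f x) F"
      using x(1) unfolding continuous_vectors_def by (auto intro: tendsto_intros)
    then show "((\<lambda>T. blinfun_apply (f o\<^sub>L Blinfun T) x) \<longlongrightarrow> f x) F"
      by (rule Lim_transform_eventually)
        (rule eventually_mono[OF F_carrier], simp add: Blinfun_apply)
  qed
  ultimately show ?thesis using f by simp
qed

text \<open>
  Used for multiplication by scalars: it makes the two summands subspaces over \<open>'k\<close>, although the
  decomposition was found with real functionals only.
\<close>

lemma continuous_vectors_commuting:
  assumes S: "bounded_linear S" and comm: "\<And>T x. T \<in> G \<Longrightarrow> T (S x) = S (T x)"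
    and x: "x \<in> continuous_vectors"
  shows "S x \<in> continuous_vectors"
proof -
  have "((\<lambda>T. S (T x)) \<longlongrightarrow> S x) F"
    using x unfolding continuous_vectors_def by (auto intro: bounded_linear.tendsto[OF S])
  then have "((\<lambda>T. T (S x)) \<longlongrightarrow> S x) F"
    by (rule Lim_transform_eventually) (rule eventually_mono[OF F_carrier], simp add: comm)
  then show ?thesis
    unfolding continuous_vectors_def by blast
qed

lemma coannihilator_commuting:
  assumes S: "bounded_linear S" and comm: "\<And>T x. T \<in> G \<Longrightarrow> T (S x) = S (T x)"
    and x: "x \<in> coannihilator"
  shows "S x \<in> coannihilator"
  unfolding coannihilator_def
proof (intro CollectI ballI)
  fix f assume f: "f \<in> continuous_functionals"
  have app: "blinfun_apply (f o\<^sub>L Blinfun S) y = f (S y)" for y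
    by (simp add: bounded_linear_Blinfun_apply[OF S])
  have "((\<lambda>T. blinfun_apply (f o\<^sub>L Blinfun S) (T y)) \<longlongrightarrow> blinfun_apply (f o\<^sub>L Blinfun S) y) F" for y
  proof -
    have "((\<lambda>T. f (T (S y))) \<longlongrightarrow> f (S y)) F"
      using f unfolding continuous_functionals_def by blast
    then show ?thesis
      unfolding app
      by (rule Lim_transform_eventually) (rule eventually_mono[OF F_carrier], simp add: comm)
  qed
  then have "f o\<^sub>L Blinfun S \<in> continuous_functionals"
    unfolding continuous_functionals_def by blast
  with x have "blinfun_apply (f o\<^sub>L Blinfun S) x = 0"
    unfolding coannihilator_def by blast
  then show "f (S x) = 0" unfolding app .
qed

lemma conj_tendsto:
  assumes S: "S \<in> G" "S' \<in> G" "S \<circ> S' = id" and lim: "(h \<longlongrightarrow> l) F"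
  shows "((\<lambda>T. h (S \<circ> T \<circ> S')) \<longlongrightarrow> l) F"
proof (rule topological_tendstoI)
  fix U assume "open U" "l \<in> U"
  then show "\<forall>\<^sub>F T in F. h (S \<circ> T \<circ> S') \<in> U"
    using F_conj[OF S, of "\<lambda>T. h T \<in> U"] topological_tendstoD[OF lim] by blast
qed

lemma continuous_vectors_invariant: "invariant_under G continuous_vectors"
  unfolding invariant_under_def
proof (intro ballI image_subsetI)
  fix S x assume S: "S \<in> G" and x: "x \<in> continuous_vectors"
  obtain S' where S': "S' \<in> G" "S' \<circ> S = id" "S \<circ> S' = id" using inverse_in[OF S] by blast
  have S'S: "S (S' y) = y" for y using S'(3) by (metis comp_apply id_apply)
  have "((\<lambda>T. T x) \<longlongrightarrow> x) F"
    using x unfolding continuous_vectors_def by blast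
  then have "((\<lambda>T. (S' \<circ> T \<circ> S) x) \<longlongrightarrow> x) F"
    by (rule conj_tendsto[OF S'(1) S S'(2)])
  then have "((\<lambda>T. S (S' (T (S x)))) \<longlongrightarrow> S x) F"
    using bounded_linear.tendsto[OF operator_bounded_linear[OF S]] by fastforce
  then show "S x \<in> continuous_vectors"
    unfolding continuous_vectors_def by (simp add: S'S)
qed

lemma coannihilator_invariant: "invariant_under G coannihilator"
  unfolding invariant_under_def
proof (intro ballI image_subsetI)
  fix S x assume S: "S \<in> G" and x: "x \<in> coannihilator"
  obtain S' where S': "S' \<in> G" "S' \<circ> S = id" "S \<circ> S' = id" using inverse_in[OF S] by blast
  have S'S: "S' (S y) = y" for y using S'(2) by (metis comp_apply id_apply)
  show "S x \<in> coannihilator"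
    unfolding coannihilator_def
  proof (intro CollectI ballI)
    fix f assume f: "f \<in> continuous_functionals"
    have "((\<lambda>T. f (S (T y))) \<longlongrightarrow> f (S y)) F" for y
    proof -
      have "((\<lambda>T. f (T (S y))) \<longlongrightarrow> f (S y)) F"
        using f unfolding continuous_functionals_def by blast
      then have "((\<lambda>T. f ((S \<circ> T \<circ> S') (S y))) \<longlongrightarrow> f (S y)) F"
        by (rule conj_tendsto[OF S S'(1,3)])
      then show ?thesis by (simp add: S'S)
    qed
    then have "f o\<^sub>L Blinfun S \<in> continuous_functionals"
      unfolding continuous_functionals_def by (simp add: Blinfun_apply S)
    with x have "blinfun_apply (f o\<^sub>L Blinfun S) x = 0"
      unfolding coannihilator_def by blast
    then show "f (S x) = 0" by (simp add: Blinfun_apply S)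
  qed
qed

lemma zero_in_continuous_vectors: "0 \<in> continuous_vectors"
proof -
  have "((\<lambda>T. 0) \<longlongrightarrow> (0::'a)) F" by (rule tendsto_const)
  then have "((\<lambda>T. T 0) \<longlongrightarrow> (0::'a)) F"
    by (rule Lim_transform_eventually)
      (rule eventually_mono[OF F_carrier], simp add: linear_0[OF bounded_linear.linear[OF operator_bounded_linear]])
  then show ?thesis unfolding continuous_vectors_def by blast
qed

lemma continuous_vectors_add:
  assumes "x \<in> continuous_vectors" "y \<in> continuous_vectors"
  shows "x + y \<in> continuous_vectors"
proof -
  have "((\<lambda>T. T x + T y) \<longlongrightarrow> x + y) F"
    using assms unfolding continuous_vectors_def by (auto intro: tendsto_add)
  then have "((\<lambda>T. T (x + y)) \<longlongrightarrow> x + y) F"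
    by (rule Lim_transform_eventually)
      (rule eventually_mono[OF F_carrier], simp add: linear_add[OF bounded_linear.linear[OF operator_bounded_linear]])
  then show ?thesis unfolding continuous_vectors_def by blast
qed

lemma closed_continuous_vectors: "closed continuous_vectors"
proof -
  have "x \<in> continuous_vectors" if x: "x \<in> closure continuous_vectors" for x
  proof -
    have "((\<lambda>T. T x) \<longlongrightarrow> x) F"
    proof (rule tendstoI)
      fix \<epsilon> :: real assume \<epsilon>: "0 < \<epsilon>"
      then have pos: "0 < \<epsilon> / (2 * (K + 1))" using K_nonneg by simp
      then obtain w where w: "w \<in> continuous_vectors" "dist w x < \<epsilon> / (2 * (K + 1))"
        using x unfolding closure_approachable by blast
      have "(K + 1) * norm (x - w) < \<epsilon> / 2"
        using w(2) K_nonneg by (simp add: dist_norm norm_minus_commute field_simps)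
      moreover have "eventually (\<lambda>T. dist (T w) w < \<epsilon> / 2) F"
        using w(1) \<epsilon> unfolding continuous_vectors_def by (auto dest: tendstoD[of _ _ _ "\<epsilon> / 2"])
      with F_carrier have "eventually (\<lambda>T. T \<in> G \<and> dist (T w) w < \<epsilon> / 2) F"
        by (rule eventually_conj)
      then show "eventually (\<lambda>T. dist (T x) x < \<epsilon>) F"
      proof (rule eventually_mono)
        fix T assume T: "T \<in> G \<and> dist (T w) w < \<epsilon> / 2"
        have "T x - x = T (x - w) + (T w - w) + (w - x)"
          using linear_diff[OF bounded_linear.linear[OF operator_bounded_linear], of T x w] T by simp
        then have "norm (T x - x) \<le> norm (T (x - w)) + norm (T w - w) + norm (w - x)"
          using norm_triangle_ineq[of "T (x - w) + (T w - w)" "w - x"]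
            norm_triangle_ineq[of "T (x - w)" "T w - w"] by simp
        moreover have "norm (T (x - w)) \<le> K * norm (x - w)"
          using T bound by blast
        moreover have "norm (w - x) = norm (x - w)"
          by (rule norm_minus_commute)
        ultimately show "dist (T x) x < \<epsilon>"
          using T \<open>(K + 1) * norm (x - w) < \<epsilon> / 2\<close>
          by (simp add: dist_norm distrib_right)
      qed
    qed
    then show ?thesis unfolding continuous_vectors_def by blast
  qed
  then show ?thesis
    unfolding closure_subset_eq[symmetric] by blast
qed

lemma zero_in_coannihilator: "0 \<in> coannihilator"
  unfolding coannihilator_def by (simp add: blinfun.zero_right)

lemma coannihilator_add: "x \<in> coannihilator \<Longrightarrow> y \<in> coannihilator \<Longrightarrow> x + y \<in> coannihilator"
  unfolding coannihilator_def by (simp add: blinfun.add_right)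

lemma closed_coannihilator: "closed coannihilator"
proof -
  have "coannihilator = (\<Inter>f\<in>continuous_functionals. {x. blinfun_apply f x = 0})"
    unfolding coannihilator_def by blast
  also have "closed \<dots>"
    by (intro closed_INT ballI closed_Collect_eq continuous_intros)
  finally show ?thesis .
qed

lemma complementary_continuous_vectors: "complementary continuous_vectors coannihilator"
  unfolding complementary_def
proof
  show "continuous_vectors \<inter> coannihilator = {0}"
    using continuous_vectors_Int_coannihilator zero_in_continuous_vectors zero_in_coannihilator by blast
  have "\<exists>y z. x = y + z \<and> y \<in> continuous_vectors \<and> z \<in> coannihilator" for x
    using vector_decomposition[of x] by (metis add_diff_cancel_left' diff_add_cancel add.commute)
  then show "{y + z |y z. y \<in> continuous_vectors \<and> z \<in> coannihilator} = UNIV"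
    by blast
qed

end

section \<open>Linear automorphisms and bounded projections\<close>

lemma linear_continuous_imp_bounded_linear:
  fixes T :: "'a::real_normed_vector \<Rightarrow> 'b::real_normed_vector"
  assumes "linear T" "continuous_on UNIV T"
  shows "bounded_linear T"
proof -
  interpret linear T by (rule assms(1))
  have "isCont T 0"
    using assms(2) by (simp add: continuous_on_eq_continuous_at)
  then obtain d where d: "0 < d" "\<And>x. dist x 0 < d \<Longrightarrow> dist (T x) (T 0) < 1"
    unfolding continuous_at_eps_delta by (metis zero_less_one)
  have "norm (T x) \<le> norm x * (2 / d)" for x
  proof (cases "x = 0")
    case True
    then show ?thesis by (simp add: zero)
  next
    case False
    let ?c = "d / (2 * norm x)"
    have "norm (T (?c *\<^sub>R x)) < 1"
      using d(2)[of "?c *\<^sub>R x"] d(1) False by (simp add: zero)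
    then have "?c * norm (T x) < 1"
      using d(1) by (simp add: scale)
    then show ?thesis
      using d(1) False by (simp add: field_simps)
  qed
  then show ?thesis
    by (intro bounded_linear_intro[of T "2 / d"]) (auto simp: add scale)
qed

context banach_over
begin

lemma subspace_scaleR: "subspace V \<Longrightarrow> x \<in> V \<Longrightarrow> r *\<^sub>R x \<in> V"
  using subspace_scale[of V x "of_real r"] by (simp add: scale_of_real)

lemma real_subspace: "subspace V \<Longrightarrow> real_vector.subspace V"
  by (rule real_vector.subspaceI) (auto intro: subspace_0 subspace_add subspace_scaleR)

lemma bounded_linear_scl: "bounded_linear (scl c)"
proof (rule bounded_linear_intro)
  show "scl c (x + y) = scl c x + scl c y" for x y
    by (rule scale_right_distrib)
  show "scl c (r *\<^sub>R x) = r *\<^sub>R scl c x" for r x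
    by (simp add: mult.commute flip: scale_of_real)
  show "norm (scl c x) \<le> norm x * norm c" for x
    by (simp add: norm_scale)
qed

lemma linear_automorphism_bounded_linear:
  assumes T: "T \<in> linear_automorphisms scl UNIV"
  shows "bounded_linear T"
proof (rule linear_continuous_imp_bounded_linear)
  show "continuous_on UNIV T" using T unfolding linear_automorphisms_def by blast
  show "linear T"
  proof (rule linearI)
    show "T (x + y) = T x + T y" for x y
      using T unfolding linear_automorphisms_def by blast
    have "T (scl (of_real r) x) = scl (of_real r) (T x)" for r x
      using T unfolding linear_automorphisms_def by blast
    then show "T (r *\<^sub>R x) = r *\<^sub>R T x" for r x
      by (simp add: scale_of_real)
  qed
qed

lemma linear_automorphisms_subgroup:
  assumes V: "subspace V"
  shows "subgroup (linear_automorphisms scl V) (BijGroup V)"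
proof (rule subgroup.intro)
  show "linear_automorphisms scl V \<subseteq> carrier (BijGroup V)"
    unfolding linear_automorphisms_def BijGroup_def by auto
next
  fix S T assume S: "S \<in> linear_automorphisms scl V" and T: "T \<in> linear_automorphisms scl V"
  have mem: "S x \<in> V" "T x \<in> V" if "x \<in> V" for x
    using S T that Bij_imp_funcset unfolding linear_automorphisms_def by blast+
  have bij: "bij_betw S V V" "bij_betw T V V" "S \<in> Bij V" "T \<in> Bij V"
    using S T unfolding linear_automorphisms_def Bij_def by auto
  have "inv_into V (compose V S T) x = inv_into V T (inv_into V S x)" if x: "x \<in> V" for x
  proof (rule inv_into_f_eq)
    show "inj_on (compose V S T) V"
      using compose_Bij[OF bij(3,4)] unfolding Bij_def bij_betw_def by auto
    show y: "inv_into V T (inv_into V S x) \<in> V"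
      using x bij by (metis bij_betw_def inv_into_into)
    show "compose V S T (inv_into V T (inv_into V S x)) = x"
      using x y bij by (simp add: compose_def bij_betw_inv_into_right inv_into_into bij_betw_imp_surj_on)
  qed
  moreover have "continuous_on V (\<lambda>x. inv_into V T (inv_into V S x))"
    by (rule continuous_on_compose2[of V "inv_into V T"])
      (use S T bij in \<open>auto simp: linear_automorphisms_def bij_betw_def intro: inv_into_into\<close>)
  ultimately have "continuous_on V (inv_into V (compose V S T))"
    by simp
  moreover have "continuous_on V (\<lambda>x. S (T x))"
    by (rule continuous_on_compose2[of V S]) (use S T mem in \<open>auto simp: linear_automorphisms_def\<close>)
  then have "continuous_on V (compose V S T)"
    by (simp add: compose_def cong: continuous_on_cong)
  ultimately have "compose V S T \<in> linear_automorphisms scl V"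
    using S T mem V compose_Bij[OF bij(3,4)] unfolding linear_automorphisms_def
    by (auto simp: compose_def subspace_add subspace_scale)
  then show "S \<otimes>\<^bsub>BijGroup V\<^esub> T \<in> linear_automorphisms scl V"
    using bij by (simp add: BijGroup_def)
next
  have "continuous_on V (inv_into V (\<lambda>x\<in>V. x))"
    by (rule continuous_on_eq[OF continuous_on_id]) (metis id_Bij Bij_def IntD2 bij_betw_inv_into_left mem_Collect_eq restrict_apply')
  then show "\<one>\<^bsub>BijGroup V\<^esub> \<in> linear_automorphisms scl V"
    using V id_Bij unfolding linear_automorphisms_def BijGroup_def
    by (auto simp: subspace_add subspace_scale cong: continuous_on_cong)
next
  fix T assume T: "T \<in> linear_automorphisms scl V"
  then have TB: "T \<in> Bij V" and bij: "bij_betw T V V" unfolding linear_automorphisms_def Bij_def by auto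
  define R where "R = (\<lambda>x\<in>V. inv_into V T x)"
  have RV: "R x \<in> V" and TR: "T (R x) = x" and RT: "R (T x) = x" and TV: "T x \<in> V" if "x \<in> V" for x
    using that bij unfolding R_def
    by (auto simp: bij_betw_inv_into_right bij_betw_inv_into_left bij_betwE bij_betw_imp_surj_on inv_into_into)
  have RB: "R \<in> Bij V" unfolding R_def by (rule restrict_inv_into_Bij[OF TB])
  have RI: "R z = w" if "w \<in> V" "T w = z" for w z
    using RT that by metis
  have "R (x + y) = R x + R y" if "x \<in> V" "y \<in> V" for x y
    by (rule RI) (use T that RV TR V in \<open>auto simp: linear_automorphisms_def subspace_add\<close>)
  moreover have "R (scl c x) = scl c (R x)" if "x \<in> V" for c x
    by (rule RI) (use T that RV TR V in \<open>auto simp: linear_automorphisms_def subspace_scale\<close>)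
  moreover have "continuous_on V R"
    using T unfolding R_def linear_automorphisms_def by (auto cong: continuous_on_cong)
  moreover have "continuous_on V (inv_into V R)"
  proof (rule continuous_on_eq)
    show "continuous_on V T" using T unfolding linear_automorphisms_def by blast
    fix x assume "x \<in> V"
    then have "inv_into V R (R (T x)) = T x"
      using RB TV unfolding Bij_def by (auto simp: bij_betw_inv_into_left)
    then show "T x = inv_into V R x"
      using RT \<open>x \<in> V\<close> by simp
  qed
  ultimately have "R \<in> linear_automorphisms scl V"
    using RB unfolding linear_automorphisms_def by blast
  then show "inv\<^bsub>BijGroup V\<^esub> T \<in> linear_automorphisms scl V"
    unfolding R_def by (simp add: inv_BijGroup[OF TB])
qed

lemma group_GL: "subspace V \<Longrightarrow> group (GL scl V)"
  unfolding GL_def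
  by (rule subgroup.subgroup_is_group[OF linear_automorphisms_subgroup group_BijGroup])

end

lemma proj_alongI:
  assumes sub: "subspace V" "subspace W" and VW: "V \<inter> W = {0}" and v: "v \<in> V" "x - v \<in> W"
  shows "proj_along V W x = v"
  unfolding proj_along_def
proof (rule the_equality)
  show "v \<in> V \<and> x - v \<in> W" using v by blast
  fix u assume u: "u \<in> V \<and> x - u \<in> W"
  have "u - v \<in> V" using u v subspace_diff[OF sub(1)] by blast
  moreover have "(x - v) - (x - u) \<in> W" using u v subspace_diff[OF sub(2)] by blast
  ultimately have "u - v \<in> V \<inter> W" by simp
  with VW show "u = v" by simp
qed

lemma proj_along_works:
  assumes sub: "subspace V" "subspace W" and VW: "complementary V W"
  shows "proj_along V W x \<in> V" "x - proj_along V W x \<in> W"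
proof -
  have "x \<in> {v + w | v w. v \<in> V \<and> w \<in> W}"
    using VW unfolding complementary_def by simp
  then obtain v w where "v \<in> V" "w \<in> W" "x = v + w" by blast
  moreover from this have "proj_along V W x = v"
    by (intro proj_alongI[OF sub]) (use VW in \<open>auto simp: complementary_def\<close>)
  ultimately show "proj_along V W x \<in> V" "x - proj_along V W x \<in> W" by auto
qed

lemma linear_proj_along:
  assumes sub: "subspace V" "subspace W" and VW: "complementary V W"
  shows "linear (proj_along V W)"
proof -
  note P = proj_along_works[OF assms]
  have I: "proj_along V W x = v" if "v \<in> V" "x - v \<in> W" for x v
    using proj_alongI[OF sub _ that] VW unfolding complementary_def by blast
  show ?thesis
  proof (rule linearI)
    show "proj_along V W (x + y) = proj_along V W x + proj_along V W y" for x y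
      by (rule I) (use P subspace_add[OF sub(1)] subspace_add[OF sub(2) P(2)[of x] P(2)[of y]] in \<open>auto simp: algebra_simps\<close>)
    show "proj_along V W (c *\<^sub>R x) = c *\<^sub>R proj_along V W x" for c x
      by (rule I) (use P subspace_scale[OF sub(1)] subspace_scale[OF sub(2) P(2)[of x], of c] in \<open>auto simp: algebra_simps\<close>)
  qed
qed

text \<open>
  The successive approximation of the open mapping theorem: the errors of repeated approximations
  form a geometric series, so the projections of the approximants can be summed up.
\<close>

lemma approximately_bounded_imp_bounded_projection:
  fixes V W :: "'a::banach set"
  assumes sub: "subspace V" "subspace W" and cl: "closed V" "closed W" and VW: "complementary V W"
    and M: "0 \<le> M" and approx: "\<And>x \<epsilon>. 0 < \<epsilon> \<Longrightarrow> \<exists>a. norm (x - a) < \<epsilon> \<and> norm (proj_along V W a) \<le> M * norm x"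
  shows "norm (proj_along V W x) \<le> 2 * M * norm x"
proof (cases "x = 0")
  case True
  then show ?thesis
    using linear_0[OF linear_proj_along[OF sub VW]] by simp
next
  case False
  let ?p = "proj_along V W"
  note lin = linear_proj_along[OF sub VW]
  define a where "a z \<epsilon> = (SOME a. norm (z - a) < \<epsilon> \<and> norm (?p a) \<le> M * norm z)" for z and \<epsilon> :: real
  have a: "norm (z - a z \<epsilon>) < \<epsilon>" "norm (?p (a z \<epsilon>)) \<le> M * norm z" if "0 < \<epsilon>" for z \<epsilon>
    using someI_ex[OF approx[OF that, of z]] unfolding a_def by blast+
  define \<epsilon> where "\<epsilon> n = norm x * (1/2) ^ n" for n
  have \<epsilon>: "0 < \<epsilon> n" for n using False by (simp add: \<epsilon>_def)
  \<comment> \<open>the error that remains after \<open>n\<close> approximations\<close>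
  define X where "X = rec_nat x (\<lambda>n z. z - a z (\<epsilon> (Suc n)))"
  have X: "X 0 = x" "X (Suc n) = X n - a (X n) (\<epsilon> (Suc n))" for n
    by (simp_all add: X_def)
  define b where "b n = a (X n) (\<epsilon> (Suc n))" for n
  have normX: "norm (X n) \<le> \<epsilon> n" for n
  proof (cases n)
    case 0 then show ?thesis by (simp add: X \<epsilon>_def)
  next
    case (Suc k)
    then show ?thesis using a(1)[OF \<epsilon>[of "Suc k"], of "X k"] by (simp add: X)
  qed
  have pb: "norm (?p (b n)) \<le> M * \<epsilon> n" for n
    using a(2)[OF \<epsilon>[of "Suc n"], of "X n"] mult_left_mono[OF normX[of n] M] unfolding b_def by linarith
  have "(\<lambda>n. (1/2::real) ^ n) sums 2"
    using geometric_sums[of "1/2::real"] by simp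
  then have "(\<lambda>n. (M * norm x) * (1/2) ^ n) sums ((M * norm x) * 2)"
    by (rule sums_mult)
  then have sums: "(\<lambda>n. M * \<epsilon> n) sums (2 * M * norm x)"
    by (simp add: \<epsilon>_def ac_simps)
  have summ: "summable (\<lambda>n. norm (?p (b n)))"
    by (rule summable_comparison_test'[OF sums_summable[OF sums], of 0]) (use pb in simp)
  then have lim: "(\<lambda>n. \<Sum>i<n. ?p (b i)) \<longlonglongrightarrow> (\<Sum>i. ?p (b i))"
    by (rule summable_LIMSEQ[OF summable_norm_cancel])
  have sumb: "(\<Sum>i<n. b i) = x - X n" for n
    by (induction n) (auto simp: X b_def)
  have psum: "(\<Sum>i<n. ?p (b i)) = ?p (x - X n)" for n
    using linear_sum[OF lin, of b "{..<n}"] by (simp add: sumb)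
  have "\<epsilon> \<longlonglongrightarrow> norm x * 0"
    unfolding \<epsilon>_def by (intro tendsto_mult tendsto_const LIMSEQ_power_zero) simp
  then have "X \<longlonglongrightarrow> 0"
    using normX by (intro Lim_null_comparison[of X \<epsilon>]) (auto intro: always_eventually)
  then have "(\<lambda>n. x - X n) \<longlonglongrightarrow> x - 0"
    by (intro tendsto_diff tendsto_const)
  then have lim2: "(\<lambda>n. (x - X n) - ?p (x - X n)) \<longlonglongrightarrow> x - (\<Sum>i. ?p (b i))"
    using tendsto_diff[OF _ lim] unfolding psum by simp
  have "(\<Sum>i. ?p (b i)) \<in> V"
    by (rule closed_sequentially[OF cl(1) _ lim]) (simp add: psum proj_along_works[OF sub VW])
  moreover have "x - (\<Sum>i. ?p (b i)) \<in> W"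
    by (rule closed_sequentially[OF cl(2) _ lim2]) (rule proj_along_works[OF sub VW])
  ultimately have "?p x = (\<Sum>i. ?p (b i))"
    using VW unfolding complementary_def by (intro proj_alongI[OF sub]) auto
  also have "norm \<dots> \<le> (\<Sum>i. norm (?p (b i)))"
    by (rule summable_norm[OF summ])
  also have "\<dots> \<le> (\<Sum>i. M * \<epsilon> i)"
    by (rule suminf_le[OF pb summ sums_summable[OF sums]])
  also have "\<dots> = 2 * M * norm x"
    by (rule sums_unique[OF sums, symmetric])
  finally show ?thesis .
qed

text \<open>
  By Baire's theorem, the closure of \<open>{x. norm (proj_along V W x) \<le> n}\<close> has interior points for some
  \<open>n\<close>. By translation and scaling, every vector is approximated by vectors whose projections are
  controlled.
\<close>

lemma bounded_linear_proj_along: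
  fixes V W :: "'a::banach set"
  assumes sub: "subspace V" "subspace W" and cl: "closed V" "closed W" and VW: "complementary V W"
  shows "bounded_linear (proj_along V W)"
proof -
  let ?p = "proj_along V W"
  note lin = linear_proj_along[OF sub VW]
  define A where "A n = {x. norm (?p x) \<le> real n}" for n
  have "x \<in> (\<Union>n. closure (A n))" for x
  proof -
    obtain n where "norm (?p x) \<le> real n" using real_arch_simple by blast
    then have "x \<in> A n" by (simp add: A_def)
    then show ?thesis using closure_subset by blast
  qed
  then have "\<Union>(range (\<lambda>n. closure (A n))) = UNIV" by blast
  then obtain T where "T \<in> range (\<lambda>n. closure (A n))" "interior T \<noteq> {}"
    by (rule Baire_countable_closed_cover[rotated 2]) auto
  then obtain n x0 where "x0 \<in> interior (closure (A n))" by blast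
  then obtain \<rho> where \<rho>: "0 < \<rho>" "ball x0 \<rho> \<subseteq> closure (A n)"
    using mem_interior by blast
  have small: "\<exists>a. norm (h - a) < \<epsilon> \<and> norm (?p a) \<le> 2 * real n" if h: "norm h < \<rho>" and \<epsilon>: "0 < \<epsilon>" for h \<epsilon>
  proof -
    have "x0 + h \<in> closure (A n)" "x0 \<in> closure (A n)"
      using \<rho> h by (auto simp: dist_norm)
    then obtain u v where u: "u \<in> A n" "dist u (x0 + h) < \<epsilon> / 2" and v: "v \<in> A n" "dist v x0 < \<epsilon> / 2"
      using \<epsilon> unfolding closure_approachable by (metis half_gt_zero)
    have "norm (h - (u - v)) \<le> norm ((x0 + h) - u) + norm (v - x0)"
      using norm_triangle_ineq[of "(x0 + h) - u" "v - x0"] by (simp add: algebra_simps)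
    also have "\<dots> < \<epsilon>"
      using u(2) v(2) by (simp add: dist_norm norm_minus_commute)
    finally have "norm (h - (u - v)) < \<epsilon>" .
    moreover have "norm (?p (u - v)) \<le> 2 * real n"
      using u(1) v(1) norm_triangle_ineq4[of "?p u" "?p v"] by (simp add: A_def linear_diff[OF lin])
    ultimately show ?thesis by blast
  qed
  define M where "M = 4 * real n / \<rho>"
  have "0 \<le> M" using \<rho>(1) by (simp add: M_def)
  have approx: "\<exists>a. norm (x - a) < \<epsilon> \<and> norm (?p a) \<le> M * norm x" if \<epsilon>: "0 < \<epsilon>" for x \<epsilon>
  proof (cases "x = 0")
    case True
    then show ?thesis using \<epsilon> linear_0[OF lin] by (intro exI[of _ 0]) simp
  next
    case False
    let ?c = "\<rho> / (2 * norm x)"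
    have c: "0 < ?c" using \<rho>(1) False by simp
    have "norm (?c *\<^sub>R x) < \<rho>" "0 < ?c * \<epsilon>"
      using \<rho>(1) False \<epsilon> by auto
    then obtain a where a: "norm (?c *\<^sub>R x - a) < ?c * \<epsilon>" "norm (?p a) \<le> 2 * real n"
      using small by blast
    have "?c *\<^sub>R x - a = ?c *\<^sub>R (x - (1 / ?c) *\<^sub>R a)"
      using \<rho>(1) False by (simp add: scaleR_diff_right)
    then have "?c * norm (x - (1 / ?c) *\<^sub>R a) < ?c * \<epsilon>"
      using a(1) c by (simp only: norm_scaleR abs_of_pos)
    then have "norm (x - (1 / ?c) *\<^sub>R a) < \<epsilon>"
      using c by (simp only: mult_less_cancel_left_pos)
    moreover have "norm (?p ((1 / ?c) *\<^sub>R a)) \<le> M * norm x"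
    proof -
      have "norm (?p ((1 / ?c) *\<^sub>R a)) = (2 * norm x / \<rho>) * norm (?p a)"
        using c \<rho>(1) by (simp add: linear_scale[OF lin])
      also have "\<dots> \<le> (2 * norm x / \<rho>) * (2 * real n)"
        using a(2) \<rho>(1) by (intro mult_left_mono) auto
      also have "\<dots> = M * norm x" by (simp add: M_def)
      finally show ?thesis .
    qed
    ultimately show ?thesis by blast
  qed
  have "norm (?p x) \<le> norm x * (2 * M)" for x
    using approximately_bounded_imp_bounded_projection[OF assms \<open>0 \<le> M\<close> approx, of x]
    by (simp add: mult.commute)
  then show ?thesis
    using lin by (intro bounded_linear_intro[of ?p "2 * M"]) (auto simp: linear_add linear_scale)
qed

section \<open>Bounded representations on a subspace\<close>

lemma continuous_map_euclideanI:
  fixes g :: "'b \<Rightarrow> 'a::metric_space"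
  assumes "\<And>s \<epsilon>. s \<in> topspace X \<Longrightarrow> 0 < \<epsilon> \<Longrightarrow> \<exists>U. openin X U \<and> s \<in> U \<and> (\<forall>t\<in>U. dist (g t) (g s) < \<epsilon>)"
  shows "continuous_map X euclidean g"
proof -
  have "topcontinuous_at X euclidean g s" if s: "s \<in> topspace X" for s
    unfolding topcontinuous_at_def
  proof (intro conjI allI impI)
    fix V assume "openin euclidean V \<and> g s \<in> V"
    then obtain \<epsilon> where \<epsilon>: "0 < \<epsilon>" "\<And>y. dist y (g s) < \<epsilon> \<Longrightarrow> y \<in> V"
      unfolding open_openin[symmetric] open_dist by metis
    obtain U where "openin X U" "s \<in> U" "\<forall>t\<in>U. dist (g t) (g s) < \<epsilon>"
      using assms[OF s \<epsilon>(1)] by blast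
    with \<epsilon>(2) show "\<exists>U. openin X U \<and> s \<in> U \<and> (\<forall>y\<in>U. g y \<in> V)" by blast
  qed (use s in auto)
  then show ?thesis
    unfolding continuous_map_eq_topcontinuous_at by blast
qed

lemma openin_SOT_basic:
  fixes V :: "'a::real_normed_vector set"
  assumes "finite X" "X \<subseteq> V"
  shows "openin (subtopology (SOT V) \<A>) {A \<in> topspace (subtopology (SOT V) \<A>). \<forall>x\<in>X. dist (A x) (b x) < \<epsilon>}"
  using assms
proof (induction X rule: finite_induct)
  case empty
  have "openin (subtopology (SOT V) \<A>) (topspace (subtopology (SOT V) \<A>))"
    by (rule openin_topspace)
  then show ?case by (simp del: topspace_subtopology)
next
  case (insert x X)
  let ?S = "subtopology (SOT V) \<A>"
  have "continuous_map ?S (top_of_set V) (\<lambda>A. A x)"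
    unfolding SOT_def
    by (rule continuous_map_from_subtopology, rule continuous_map_product_projection) (use insert in auto)
  then have "continuous_map ?S euclidean (\<lambda>A. A x)"
    by (simp add: continuous_map_in_subtopology)
  then have "openin ?S {A \<in> topspace ?S. A x \<in> ball (b x) \<epsilon>}"
    by (rule openin_continuous_map_preimage) simp
  then have "openin ?S ({A \<in> topspace ?S. A x \<in> ball (b x) \<epsilon>} \<inter> {A \<in> topspace ?S. \<forall>x\<in>X. dist (A x) (b x) < \<epsilon>})"
    using insert by (intro openin_Int) auto
  also have "{A \<in> topspace ?S. A x \<in> ball (b x) \<epsilon>} \<inter> {A \<in> topspace ?S. \<forall>x\<in>X. dist (A x) (b x) < \<epsilon>}
      = {A \<in> topspace ?S. \<forall>x\<in>insert x X. dist (A x) (b x) < \<epsilon>}"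
    by (auto simp: dist_commute)
  finally show ?case .
qed

text \<open>
  A bounded representation \<open>h\<close> of \<open>G\<close> on a subspace \<open>V\<close> that is dominated by the given action. The
  diagonal blocks are the examples: \<open>C\<close> is then the norm of the projection onto \<open>V\<close>.
\<close>

locale bounded_group_representation = banach_over scl
  for scl :: "'k::{real_normed_field,euclidean_space} \<Rightarrow> 'a::banach \<Rightarrow> 'a" +
  fixes G :: "('a \<Rightarrow> 'a) set" and V :: "'a set" and h :: "('a \<Rightarrow> 'a) \<Rightarrow> 'a \<Rightarrow> 'a" and K C :: real
  assumes separable: "\<exists>Q::'a set. countable Q \<and> closure Q = UNIV"
    and reflexive: "reflexive_space scl"
    and G: "subgroup G (GL scl UNIV)"
    and bound: "T \<in> G \<Longrightarrow> norm (T x) \<le> K * norm x" and K_nonneg: "0 \<le> K"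
    and V: "subspace V"
    and h_extensional: "T \<in> G \<Longrightarrow> h T \<in> extensional V"
    and h_in: "T \<in> G \<Longrightarrow> x \<in> V \<Longrightarrow> h T x \<in> V"
    and h_add: "T \<in> G \<Longrightarrow> x \<in> V \<Longrightarrow> y \<in> V \<Longrightarrow> h T (x + y) = h T x + h T y"
    and h_scale: "T \<in> G \<Longrightarrow> x \<in> V \<Longrightarrow> h T (scl c x) = scl c (h T x)"
    and h_comp: "S \<in> G \<Longrightarrow> T \<in> G \<Longrightarrow> x \<in> V \<Longrightarrow> h (S \<circ> T) x = h S (h T x)"
    and h_id: "x \<in> V \<Longrightarrow> h id x = x"
    and h_dominated: "S \<in> G \<Longrightarrow> T \<in> G \<Longrightarrow> x \<in> V \<Longrightarrow> norm (h S x - h T x) \<le> C * norm (S x - T x)"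
    and h_bound: "T \<in> G \<Longrightarrow> x \<in> V \<Longrightarrow> norm (h T x) \<le> C * K * norm x" and C_nonneg: "0 \<le> C"
begin

text \<open>
  A strictly positive common bound of the operators \<open>h T\<close>, by which one can divide.
\<close>

definition L :: real where "L = C * K + 1"

lemma L_pos: "0 < L" using K_nonneg C_nonneg by (simp add: L_def add_nonneg_pos)

lemma h_bound_L: "T \<in> G \<Longrightarrow> x \<in> V \<Longrightarrow> norm (h T x) \<le> L * norm x"
  using h_bound[of T x] by (simp add: L_def distrib_right add_increasing2)

lemma h_diff: "T \<in> G \<Longrightarrow> x \<in> V \<Longrightarrow> y \<in> V \<Longrightarrow> h T (x - y) = h T x - h T y"
  using h_add[of T "x - y" y] subspace_diff[OF V] by simp

lemma G_automorphism: "T \<in> G \<Longrightarrow> T \<in> linear_automorphisms scl UNIV"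
  using subgroup.subset[OF G] by (auto simp: GL_def)

lemma G_bounded_linear: "T \<in> G \<Longrightarrow> bounded_linear T"
  by (rule linear_automorphism_bounded_linear[OF G_automorphism])

lemma G_scl: "T \<in> G \<Longrightarrow> T (scl c x) = scl c (T x)"
  using G_automorphism unfolding linear_automorphisms_def by blast

lemma GL_mult: "S \<in> G \<Longrightarrow> T \<in> G \<Longrightarrow> S \<otimes>\<^bsub>GL scl UNIV\<^esub> T = S \<circ> T"
  using G_automorphism[of S] G_automorphism[of T]
  by (auto simp: GL_def BijGroup_def linear_automorphisms_def compose_def fun_eq_iff)

lemma GL_one: "\<one>\<^bsub>GL scl UNIV\<^esub> = id"
  by (auto simp: GL_def BijGroup_def)

lemma G_id: "id \<in> G"
  using subgroup.one_closed[OF G] by (simp add: GL_one)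

lemma G_comp: "S \<in> G \<Longrightarrow> T \<in> G \<Longrightarrow> S \<circ> T \<in> G"
  using subgroup.m_closed[OF G] by (metis GL_mult)

lemma G_inverse:
  assumes T: "T \<in> G"
  obtains S where "S \<in> G" "S \<circ> T = id" "T \<circ> S = id"
proof -
  interpret GL: group "GL scl UNIV" by (rule group_GL) (rule subspace_UNIV)
  let ?S = "inv\<^bsub>GL scl UNIV\<^esub> T"
  have S: "?S \<in> G" by (rule subgroup.m_inv_closed[OF G T])
  have "T \<in> carrier (GL scl UNIV)" using T subgroup.subset[OF G] by blast
  then have "?S \<circ> T = id" "T \<circ> ?S = id"
    using GL.l_inv GL.r_inv GL_mult[OF S T] GL_mult[OF T S] GL_one by metis+
  with S that show thesis by blast
qed

definition basic_nbhd :: "'a set \<Rightarrow> real \<Rightarrow> ('a \<Rightarrow> 'a) set"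
  where "basic_nbhd X \<delta> = {T \<in> G. \<forall>x\<in>X. norm (h T x - x) < \<delta>}"

text \<open>
  The neighbourhoods of the identity in the strong operator topology of \<open>V\<close>, pulled back along \<open>h\<close>.
\<close>

definition near_identity :: "('a \<Rightarrow> 'a) filter"
  where "near_identity = (INF (X, \<delta>)\<in>{(X, \<delta>). finite X \<and> X \<subseteq> V \<and> 0 < \<delta>}. principal (basic_nbhd X \<delta>))"

lemma eventually_near_identity:
  "eventually P near_identity \<longleftrightarrow>
    (\<exists>X \<delta>. finite X \<and> X \<subseteq> V \<and> 0 < \<delta> \<and> (\<forall>T\<in>basic_nbhd X \<delta>. P T))"
proof -
  let ?I = "{(X, \<delta>). finite X \<and> X \<subseteq> V \<and> 0 < (\<delta>::real)}"
  have "eventually P (INF i\<in>?I. case i of (X, \<delta>) \<Rightarrow> principal (basic_nbhd X \<delta>)) \<longleftrightarrow>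
    (\<exists>i\<in>?I. eventually P (case i of (X, \<delta>) \<Rightarrow> principal (basic_nbhd X \<delta>)))"
  proof (rule eventually_INF_base)
    have "({}, 1) \<in> ?I" by simp
    then show "?I \<noteq> {}" by blast
    fix a b assume "a \<in> ?I" "b \<in> ?I"
    then obtain X \<delta> Y \<eta> where *: "a = (X, \<delta>)" "b = (Y, \<eta>)" "finite X" "X \<subseteq> V" "0 < \<delta>" "finite Y" "Y \<subseteq> V" "0 < \<eta>"
      by blast
    show "\<exists>c\<in>?I. (case c of (X, \<delta>) \<Rightarrow> principal (basic_nbhd X \<delta>))
        \<le> inf (case a of (X, \<delta>) \<Rightarrow> principal (basic_nbhd X \<delta>)) (case b of (X, \<delta>) \<Rightarrow> principal (basic_nbhd X \<delta>))"
      using * by (intro bexI[of _ "(X \<union> Y, min \<delta> \<eta>)"]) (auto simp: basic_nbhd_def)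
  qed
  then show ?thesis
    unfolding near_identity_def by (auto simp: eventually_principal)
qed

lemma id_near_identity: "eventually P near_identity \<Longrightarrow> P id"
  unfolding eventually_near_identity basic_nbhd_def using G_id h_id by force

lemma h_tendsto:
  assumes x: "x \<in> V"
  shows "((\<lambda>T. h T x) \<longlongrightarrow> x) near_identity"
proof (rule tendstoI)
  fix \<epsilon> :: real assume "0 < \<epsilon>"
  then show "eventually (\<lambda>T. dist (h T x) x < \<epsilon>) near_identity"
    unfolding eventually_near_identity using x
    by (intro exI[of _ "{x}"] exI[of _ \<epsilon>]) (auto simp: basic_nbhd_def dist_norm)
qed

lemma near_identity_mult:
  assumes "eventually P near_identity"
  shows "\<exists>Q. eventually Q near_identity \<and> (\<forall>S\<in>G. \<forall>T\<in>G. Q S \<longrightarrow> Q T \<longrightarrow> P (S \<circ> T))"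
proof -
  obtain X \<delta> where X: "finite X" "X \<subseteq> V" "0 < \<delta>" "\<And>T. T \<in> basic_nbhd X \<delta> \<Longrightarrow> P T"
    using assms unfolding eventually_near_identity by blast
  let ?\<eta> = "\<delta> / (L + 1)"
  have "0 < ?\<eta>" using X(3) L_pos by simp
  then have "eventually (\<lambda>T. T \<in> basic_nbhd X ?\<eta>) near_identity"
    unfolding eventually_near_identity using X by blast
  moreover have "P (S \<circ> T)" if S: "S \<in> basic_nbhd X ?\<eta>" and T: "T \<in> basic_nbhd X ?\<eta>" for S T
  proof (rule X(4))
    have ST: "S \<in> G" "T \<in> G" using S T by (auto simp: basic_nbhd_def)
    have "norm (h (S \<circ> T) x - x) < \<delta>" if x: "x \<in> X" for x
    proof -
      have xV: "x \<in> V" using x X by blast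
      have "h (S \<circ> T) x - x = h S (h T x - x) + (h S x - x)"
        using h_comp[OF ST xV] h_diff[OF ST(1) h_in[OF ST(2) xV] xV] by simp
      then have "norm (h (S \<circ> T) x - x) \<le> norm (h S (h T x - x)) + norm (h S x - x)"
        using norm_triangle_ineq[of "h S (h T x - x)" "h S x - x"] by (simp only:)
      also have "norm (h S (h T x - x)) \<le> L * norm (h T x - x)"
        by (rule h_bound_L[OF ST(1) subspace_diff[OF V h_in[OF ST(2) xV] xV]])
      also have "L * norm (h T x - x) \<le> L * ?\<eta>"
        using T x L_pos by (intro mult_left_mono) (auto simp: basic_nbhd_def)
      finally have "norm (h (S \<circ> T) x - x) < L * ?\<eta> + ?\<eta>"
        using S x by (auto simp: basic_nbhd_def)
      also have "L * ?\<eta> + ?\<eta> = (L + 1) * ?\<eta>"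
        by (simp only: distrib_right mult_1_left)
      also have "\<dots> = \<delta>"
        using L_pos by simp
      finally show ?thesis .
    qed
    then show "S \<circ> T \<in> basic_nbhd X \<delta>"
      using G_comp[OF ST] unfolding basic_nbhd_def by blast
  qed
  ultimately show ?thesis by blast
qed

lemma near_identity_conj:
  assumes S: "S \<in> G" "S' \<in> G" "S \<circ> S' = id" and P: "eventually P near_identity"
  shows "eventually (\<lambda>T. P (S \<circ> T \<circ> S')) near_identity"
proof -
  obtain X \<delta> where X: "finite X" "X \<subseteq> V" "0 < \<delta>" "\<And>T. T \<in> basic_nbhd X \<delta> \<Longrightarrow> P T"
    using P unfolding eventually_near_identity by blast
  let ?\<eta> = "\<delta> / L"
  have "finite (h S' ` X)" "h S' ` X \<subseteq> V" "0 < ?\<eta>"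
    using X h_in[OF S(2)] L_pos by auto
  moreover have "P (S \<circ> T \<circ> S')" if T: "T \<in> basic_nbhd (h S' ` X) ?\<eta>" for T
  proof (rule X(4))
    have TG: "T \<in> G" using T by (simp add: basic_nbhd_def)
    have "norm (h (S \<circ> T \<circ> S') x - x) < \<delta>" if x: "x \<in> X" for x
    proof -
      have xV: "x \<in> V" using x X by blast
      let ?y = "h S' x"
      have y: "?y \<in> V" by (rule h_in[OF S(2) xV])
      have "h S ?y = x"
        using h_comp[OF S(1,2) xV] S(3) h_id[OF xV] by simp
      then have "h (S \<circ> T \<circ> S') x - x = h S (h T ?y - ?y)"
        using h_comp[OF G_comp[OF S(1) TG] S(2) xV] h_comp[OF S(1) TG y] h_diff[OF S(1) h_in[OF TG y] y]
        by simp
      also have "norm \<dots> \<le> L * norm (h T ?y - ?y)"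
        by (rule h_bound_L[OF S(1) subspace_diff[OF V h_in[OF TG y] y]])
      also have "\<dots> < L * ?\<eta>"
        using T x L_pos by (intro mult_strict_left_mono) (auto simp: basic_nbhd_def)
      finally show ?thesis using L_pos by simp
    qed
    then show "S \<circ> T \<circ> S' \<in> basic_nbhd X \<delta>"
      using G_comp[OF G_comp[OF S(1) TG] S(2)] unfolding basic_nbhd_def by blast
  qed
  ultimately show ?thesis
    unfolding eventually_near_identity by blast
qed

lemma near_identity_bounded_operator_filter: "bounded_operator_filter G K near_identity"
proof (rule bounded_operator_filter.intro)
  show "\<exists>S\<in>G. S \<circ> T = id \<and> T \<circ> S = id" if "T \<in> G" for T
    using G_inverse[OF that] by metis
  show "near_identity \<noteq> bot"
    using id_near_identity[of "\<lambda>_. False"] by (auto simp: trivial_limit_def)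
  show "eventually (\<lambda>T. T \<in> G) near_identity"
    unfolding eventually_near_identity by (intro exI[of _ "{}"] exI[of _ 1]) (auto simp: basic_nbhd_def)
qed (fact separable real_reflexive[OF reflexive] G_bounded_linear bound K_nonneg G_id G_comp
      near_identity_mult near_identity_conj)+

sublocale bounded_operator_filter G K near_identity
  by (rule near_identity_bounded_operator_filter)

lemma closed_subspace_continuous_vectors: "closed_subspace scl continuous_vectors"
  unfolding closed_subspace_def
  by (intro conjI subspaceI closed_continuous_vectors zero_in_continuous_vectors continuous_vectors_add
      continuous_vectors_commuting[OF bounded_linear_scl G_scl])

lemma closed_subspace_coannihilator: "closed_subspace scl coannihilator"
  unfolding closed_subspace_def
  by (intro conjI subspaceI closed_coannihilator zero_in_coannihilator coannihilator_add
      coannihilator_commuting[OF bounded_linear_scl G_scl])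

lemma h_inverse:
  assumes "S \<in> G" "T \<in> G" "S \<circ> T = id" "x \<in> V"
  shows "h S (h T x) = x"
  using h_comp[OF assms(1,2,4)] assms(3) h_id[OF assms(4)] by simp

lemma h_automorphism:
  assumes T: "T \<in> G"
  shows "h T \<in> linear_automorphisms scl V"
proof -
  obtain S where S: "S \<in> G" "S \<circ> T = id" "T \<circ> S = id" using G_inverse[OF T] .
  have cont: "continuous_on V (h R)" if R: "R \<in> G" for R
  proof (rule continuous_onI)
    fix x \<epsilon> assume x: "x \<in> V" and \<epsilon>: "0 < (\<epsilon>::real)"
    have "dist (h R y) (h R x) \<le> \<epsilon>" if y: "y \<in> V" "dist y x < \<epsilon> / L" for y
    proof -
      have "dist (h R y) (h R x) = norm (h R (y - x))"
        using h_diff[OF R y(1) x] by (simp add: dist_norm)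
      also have "\<dots> \<le> L * norm (y - x)"
        by (rule h_bound_L[OF R subspace_diff[OF V y(1) x]])
      also have "\<dots> \<le> L * (\<epsilon> / L)"
        using y(2) L_pos by (intro mult_left_mono) (auto simp: dist_norm)
      finally show ?thesis using L_pos by simp
    qed
    then show "\<exists>d>0. \<forall>y\<in>V. dist y x < d \<longrightarrow> dist (h R y) (h R x) \<le> \<epsilon>"
      using \<epsilon> L_pos by (intro exI[of _ "\<epsilon> / L"]) auto
  qed
  have bij: "bij_betw (h T) V V"
    by (rule bij_betw_byWitness[of V "h S"])
      (use h_inverse[OF S(1) T S(2)] h_inverse[OF T S(1) S(3)] h_in S(1) T in auto)
  have "inv_into V (h T) x = h S x" if x: "x \<in> V" for x
    using bij h_in[OF S(1) x] h_inverse[OF T S(1) S(3) x] by (metis bij_betw_inv_into_left)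
  then have "continuous_on V (inv_into V (h T))"
    using cont[OF S(1)] by (simp cong: continuous_on_cong)
  then show ?thesis
    using bij h_extensional[OF T] h_add[OF T] h_scale[OF T] cont[OF T]
    unfolding linear_automorphisms_def Bij_def by blast
qed

lemma h_hom: "h \<in> hom ((GL scl UNIV)\<lparr>carrier := G\<rparr>) (GL scl V)"
proof (rule homI)
  show "h T \<in> carrier (GL scl V)" if "T \<in> carrier ((GL scl UNIV)\<lparr>carrier := G\<rparr>)" for T
    using that h_automorphism by (simp add: GL_def)
  fix S T assume "S \<in> carrier ((GL scl UNIV)\<lparr>carrier := G\<rparr>)" "T \<in> carrier ((GL scl UNIV)\<lparr>carrier := G\<rparr>)"
  then have ST: "S \<in> G" "T \<in> G" by auto
  have "h (S \<circ> T) = compose V (h S) (h T)"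
  proof (rule extensionalityI)
    show "h (S \<circ> T) \<in> extensional V" by (rule h_extensional[OF G_comp[OF ST]])
    show "compose V (h S) (h T) \<in> extensional V" by (rule compose_extensional)
    show "h (S \<circ> T) x = compose V (h S) (h T) x" if "x \<in> V" for x
      using that h_comp[OF ST] by (simp add: compose_def)
  qed
  moreover have "h S \<in> Bij V" "h T \<in> Bij V"
    using h_automorphism ST unfolding linear_automorphisms_def by blast+
  ultimately show "h (S \<otimes>\<^bsub>(GL scl UNIV)\<lparr>carrier := G\<rparr>\<^esub> T) = h S \<otimes>\<^bsub>GL scl V\<^esub> h T"
    using GL_mult[OF ST] by (simp add: GL_def BijGroup_def)
qed

lemma trivial_representation_imp_id:
  assumes all: "continuous_vectors = UNIV" and T: "T \<in> G" "\<And>x. x \<in> V \<Longrightarrow> h T x = x"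
  shows "T = id"
proof
  fix x
  have "dist (T x) x < \<epsilon>" if \<epsilon>: "0 < \<epsilon>" for \<epsilon>
  proof -
    have "((\<lambda>T. T x) \<longlongrightarrow> x) near_identity"
      using all unfolding continuous_vectors_def by blast
    then have "eventually (\<lambda>T. dist (T x) x < \<epsilon>) near_identity"
      using \<epsilon> by (rule tendstoD)
    then obtain X \<delta> where X: "X \<subseteq> V" "0 < \<delta>" "\<And>T. T \<in> basic_nbhd X \<delta> \<Longrightarrow> dist (T x) x < \<epsilon>"
      unfolding eventually_near_identity by blast
    have "T \<in> basic_nbhd X \<delta>"
      using T X unfolding basic_nbhd_def by auto
    then show ?thesis by (rule X(3))
  qed
  then show "T x = id x"
    by (metis dist_nz id_apply order_less_irrefl)
qed

lemma h_inj:
  assumes all: "continuous_vectors = UNIV"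
  shows "inj_on h G"
proof (rule inj_onI)
  fix S T assume S: "S \<in> G" and T: "T \<in> G" and eq: "h S = h T"
  obtain R where R: "R \<in> G" "R \<circ> S = id" "S \<circ> R = id" using G_inverse[OF S] .
  have "R \<circ> T = id"
  proof (rule trivial_representation_imp_id[OF all G_comp[OF R(1) T]])
    fix x assume x: "x \<in> V"
    show "h (R \<circ> T) x = x"
      using h_comp[OF R(1) T x] h_inverse[OF R(1) S R(2) x] eq by simp
  qed
  then have "S \<circ> (R \<circ> T) = S" by simp
  then show "S = T"
    using R(3) by (simp flip: comp_assoc)
qed

lemma continuous_map_h:
  "continuous_map (subtopology (SOT UNIV) G) (subtopology (SOT V) (h ` G)) h"
proof -
  let ?X = "subtopology (SOT UNIV) G"
  have top: "topspace ?X = G"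
    by (auto simp: SOT_def PiE_def extensional_def)
  have "continuous_map ?X euclidean (\<lambda>T. h T x)" if x: "x \<in> V" for x
  proof (rule continuous_map_euclideanI)
    fix S and \<epsilon> :: real assume S: "S \<in> topspace ?X" and \<epsilon>: "0 < \<epsilon>"
    let ?U = "{T \<in> topspace ?X. \<forall>y\<in>{x}. dist (T y) (S y) < \<epsilon> / (C + 1)}"
    have "openin ?X ?U" by (rule openin_SOT_basic) auto
    moreover have "S \<in> ?U" using S \<epsilon> C_nonneg by simp
    moreover have "dist (h T x) (h S x) < \<epsilon>" if T: "T \<in> ?U" for T
    proof -
      have "dist (h T x) (h S x) \<le> C * norm (T x - S x)"
        using h_dominated[of T S x] T S x top by (simp add: dist_norm)
      also have "\<dots> \<le> C * (\<epsilon> / (C + 1))"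
        using T C_nonneg by (intro mult_left_mono) (auto simp: dist_norm)
      also have "\<dots> < \<epsilon>"
        using \<epsilon> C_nonneg by (simp add: field_simps)
      finally show ?thesis .
    qed
    ultimately show "\<exists>U. openin ?X U \<and> S \<in> U \<and> (\<forall>T\<in>U. dist (h T x) (h S x) < \<epsilon>)" by blast
  qed
  then have "continuous_map ?X (SOT V) h"
    unfolding SOT_def[of V] continuous_map_componentwise continuous_map_in_subtopology top
    using h_extensional h_in by auto
  then show ?thesis
    unfolding continuous_map_in_subtopology top by blast
qed

lemma continuous_map_h_inverse:
  assumes all: "continuous_vectors = UNIV"
  shows "continuous_map (subtopology (SOT V) (h ` G)) (subtopology (SOT UNIV) G) (inv_into G h)"
proof -
  let ?X = "subtopology (SOT V) (h ` G)" and ?k = "inv_into G h"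
  have kh: "?k (h T) = T" if "T \<in> G" for T
    by (rule inv_into_f_f[OF h_inj[OF all] that])
  have top: "topspace ?X = h ` G"
    using h_extensional h_in by (auto simp: SOT_def PiE_def)
  have "continuous_map ?X euclidean (\<lambda>A. ?k A x)" for x
  proof (rule continuous_map_euclideanI)
    fix A and \<epsilon> :: real assume "A \<in> topspace ?X" and \<epsilon>: "0 < \<epsilon>"
    then obtain S where S: "S \<in> G" "A = h S" unfolding top by blast
    obtain R where R: "R \<in> G" "R \<circ> S = id" "S \<circ> R = id" using G_inverse[OF S(1)] .
    have "((\<lambda>T. T x) \<longlongrightarrow> x) near_identity"
      using all unfolding continuous_vectors_def by blast
    then have "eventually (\<lambda>T. dist (T x) x < \<epsilon> / (K + 1)) near_identity"
      using \<epsilon> K_nonneg by (intro tendstoD) auto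
    then obtain X \<delta> where X: "finite X" "X \<subseteq> V" "0 < \<delta>"
      "\<And>T. T \<in> basic_nbhd X \<delta> \<Longrightarrow> dist (T x) x < \<epsilon> / (K + 1)"
      unfolding eventually_near_identity by blast
    let ?U = "{B \<in> topspace ?X. \<forall>y\<in>X. dist (B y) (A y) < \<delta> / L}"
    have "openin ?X ?U" by (rule openin_SOT_basic[OF X(1,2)])
    moreover have "A \<in> ?U" using \<open>A \<in> topspace ?X\<close> X(3) L_pos by simp
    moreover have "dist (?k B x) (?k A x) < \<epsilon>" if B: "B \<in> ?U" for B
    proof -
      obtain T where T: "T \<in> G" "B = h T" using B unfolding top by blast
      \<comment> \<open>translation by \<open>R\<close> turns closeness to \<open>S\<close> into closeness to the identity\<close>
      have "norm (h (R \<circ> T) y - y) < \<delta>" if y: "y \<in> X" for y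
      proof -
        have yV: "y \<in> V" using y X by blast
        have "h (R \<circ> T) y - y = h R (h T y - h S y)"
          using h_comp[OF R(1) T(1) yV] h_inverse[OF R(1) S(1) R(2) yV]
            h_diff[OF R(1) h_in[OF T(1) yV] h_in[OF S(1) yV]] by simp
        also have "norm \<dots> \<le> L * norm (h T y - h S y)"
          by (rule h_bound_L[OF R(1) subspace_diff[OF V h_in[OF T(1) yV] h_in[OF S(1) yV]]])
        also have "\<dots> < L * (\<delta> / L)"
          using B y L_pos unfolding T(2) S(2) by (intro mult_strict_left_mono) (auto simp: dist_norm)
        finally show ?thesis using L_pos by simp
      qed
      then have "R \<circ> T \<in> basic_nbhd X \<delta>"
        using G_comp[OF R(1) T(1)] unfolding basic_nbhd_def by blast
      then have near: "norm (R (T x) - x) < \<epsilon> / (K + 1)"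
        using X(4) by (fastforce simp: dist_norm)
      have "S (R (T x)) = T x" using R(3) by (metis comp_apply id_apply)
      then have "T x - S x = S (R (T x) - x)"
        using linear_diff[OF bounded_linear.linear[OF G_bounded_linear[OF S(1)]], of "R (T x)" x] by simp
      then have "norm (T x - S x) \<le> K * norm (R (T x) - x)"
        using bound[OF S(1)] by simp
      also have "\<dots> \<le> K * (\<epsilon> / (K + 1))"
        using near K_nonneg by (intro mult_left_mono) auto
      also have "\<dots> < \<epsilon>"
        using \<epsilon> K_nonneg by (simp add: field_simps)
      finally show ?thesis
        unfolding S(2) T(2) by (simp add: kh S(1) T(1) dist_norm)
    qed
    ultimately show "\<exists>U. openin ?X U \<and> A \<in> U \<and> (\<forall>B\<in>U. dist (?k B x) (?k A x) < \<epsilon>)" by blast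
  qed
  then have "continuous_map ?X (SOT UNIV) ?k"
    unfolding SOT_def[of UNIV] continuous_map_componentwise by (simp add: extensional_def)
  moreover have "?k ` topspace ?X \<subseteq> G"
    unfolding top using kh by auto
  ultimately show ?thesis
    unfolding continuous_map_in_subtopology by blast
qed

text \<open>
  If \<open>T x \<longlonglongrightarrow> x\<close> whenever \<open>h T\<close> tends to the identity, then \<open>h\<close> has a trivial kernel and its inverse
  is continuous at the identity, hence everywhere since \<open>h\<close> is a homomorphism.
\<close>

theorem sot_iso_onto_image_if_all_continuous:
  assumes all: "continuous_vectors = UNIV"
  shows "sot_iso_onto_image scl G V h"
proof -
  have groups: "group ((GL scl UNIV)\<lparr>carrier := G\<rparr>)" "group (GL scl V)"
    using subgroup.subgroup_is_group[OF G group_GL[OF subspace_UNIV]] group_GL[OF V] by auto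
  interpret group_hom "(GL scl UNIV)\<lparr>carrier := G\<rparr>" "GL scl V" h
    by (intro group_hom.intro group_hom_axioms.intro groups h_hom)
  have sub: "subgroup (h ` G) (GL scl V)"
    using img_is_subgroup by simp
  have "h \<in> hom ((GL scl UNIV)\<lparr>carrier := G\<rparr>) ((GL scl V)\<lparr>carrier := h ` G\<rparr>)"
    using h_hom unfolding hom_def by auto
  then have iso: "h \<in> iso ((GL scl UNIV)\<lparr>carrier := G\<rparr>) ((GL scl V)\<lparr>carrier := h ` G\<rparr>)"
    unfolding iso_def using h_inj[OF all] by (auto simp: bij_betw_def)
  have "homeomorphic_maps (subtopology (SOT UNIV) G) (subtopology (SOT V) (h ` G)) h (inv_into G h)"
    unfolding homeomorphic_maps_def
    using continuous_map_h continuous_map_h_inverse[OF all] inv_into_f_f[OF h_inj[OF all]]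
    by (auto simp: f_inv_into_f)
  then have "homeomorphic_map (subtopology (SOT UNIV) G) (subtopology (SOT V) (h ` G)) h"
    unfolding homeomorphic_map_maps by blast
  with sub iso show ?thesis
    unfolding sot_iso_onto_image_def topological_group_iso_def by simp
qed

end

section \<open>Diagonal blocks of a triangular group\<close>

context banach_over
begin

text \<open>
  The block at \<open>V\<close> is multiplicative as soon as the group is triangular in either direction: if \<open>V\<close> is
  invariant it is a restriction, and if \<open>W\<close> is invariant it is the action on the quotient by \<open>W\<close>.
\<close>

lemma diag_block_representation:
  assumes separable: "\<exists>Q::'a set. countable Q \<and> closure Q = UNIV"
    and reflexive: "reflexive_space scl"
    and G: "subgroup G (GL scl UNIV)"
    and bound: "\<And>T x. T \<in> G \<Longrightarrow> norm (T x) \<le> K * norm x" and K: "0 \<le> K"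
    and V: "closed_subspace scl V" and W: "closed_subspace scl W" and VW: "complementary V W"
    and inv: "invariant_under G V \<or> invariant_under G W"
  shows "bounded_group_representation scl G V (diag_block V W) K (onorm (proj_along V W))"
proof -
  let ?p = "proj_along V W" and ?h = "diag_block V W"
  have sV: "subspace V" "closed V" and sW: "subspace W" "closed W"
    using V W unfolding closed_subspace_def by auto
  note real = real_subspace[OF sV(1)] real_subspace[OF sW(1)]
  note P = proj_along_works[OF real VW]
  have p: "bounded_linear ?p"
    by (rule bounded_linear_proj_along[OF real sV(2) sW(2) VW])
  interpret p: bounded_linear ?p by (rule p)
  have I: "?p x = v" if "v \<in> V" "x - v \<in> W" for x v
    using proj_alongI[OF real _ that] VW unfolding complementary_def by blast
  have p_id: "?p x = x" if "x \<in> V" for x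
    by (rule I) (use that subspace_0[OF sW(1)] in auto)
  have p_0: "?p x = 0" if "x \<in> W" for x
    by (rule I) (use that subspace_0[OF sV(1)] in auto)
  have p_scl: "?p (scl c x) = scl c (?p x)" for c x
    using P[of x] subspace_scale[OF sV(1)] subspace_scale[OF sW(1), of "x - ?p x" c]
    by (intro I) (auto simp: scale_right_diff_distrib)
  have h: "?h T x = ?p (T x)" if "x \<in> V" for T x
    using that by (simp add: diag_block_def)
  have T: "T \<in> linear_automorphisms scl UNIV" if "T \<in> G" for T
    using that subgroup.subset[OF G] by (auto simp: GL_def)
  have Tlin: "linear T" and Tscl: "T (scl c x) = scl c (T x)" if "T \<in> G" for T c x
    using bounded_linear.linear[OF linear_automorphism_bounded_linear[OF T[OF that]]] T[OF that]
    by (auto simp: linear_automorphisms_def)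
  have comp: "?p (S (T x)) = ?p (S (?p (T x)))" if S: "S \<in> G" and T: "T \<in> G" and x: "x \<in> V" for S T x
    using inv
  proof
    assume "invariant_under G V"
    then have "T x \<in> V" using T x unfolding invariant_under_def by blast
    then show ?thesis by (simp add: p_id)
  next
    assume "invariant_under G W"
    then have "S (T x - ?p (T x)) \<in> W" using S P(2) unfolding invariant_under_def by blast
    then have "?p (S (T x - ?p (T x))) = 0" by (rule p_0)
    then show ?thesis by (simp add: linear_diff[OF Tlin[OF S]] p.diff)
  qed
  have p_le: "norm (?p x) \<le> onorm ?p * norm x" for x
    by (rule onorm[OF p])
  show ?thesis
  proof (intro bounded_group_representation.intro bounded_group_representation_axioms.intro banach_over_axioms)
    show "?h T \<in> extensional V" for T by (simp add: diag_block_def)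
    show "?h T x \<in> V" if "x \<in> V" for T x using that P(1) h by simp
    show "?h T (x + y) = ?h T x + ?h T y" if "T \<in> G" "x \<in> V" "y \<in> V" for T x y
      using that by (simp add: h subspace_add[OF sV(1)] linear_add[OF Tlin] p.add)
    show "?h T (scl c x) = scl c (?h T x)" if "T \<in> G" "x \<in> V" for T c x
      using that by (simp add: h subspace_scale[OF sV(1)] Tscl p_scl)
    show "?h (S \<circ> T) x = ?h S (?h T x)" if "S \<in> G" "T \<in> G" "x \<in> V" for S T x
      using that comp P(1) by (simp add: h)
    show "?h id x = x" if "x \<in> V" for x using that by (simp add: h p_id)
    show "norm (?h S x - ?h T x) \<le> onorm ?p * norm (S x - T x)" if "x \<in> V" for S T x
      using p_le[of "S x - T x"] that by (simp add: h p.diff)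
    show "norm (?h T x) \<le> onorm ?p * K * norm x" if "T \<in> G" "x \<in> V" for T x
      using p_le[of "T x"] mult_left_mono[OF bound[OF that(1)] onorm_pos_le[OF p], of x] that(2)
      by (simp add: h mult.assoc)
  qed (fact separable reflexive G bound K sV(1) onorm_pos_le[OF p])+
qed

end

lemma complementary_commute: "complementary V W \<longleftrightarrow> complementary W V"
proof -
  have "{v + w | v w. v \<in> V \<and> w \<in> W} = {w + v | w v. w \<in> W \<and> v \<in> V}"
    by (auto intro: add.commute)
  then show ?thesis
    unfolding complementary_def by (simp add: Int_commute)
qed

theorem theorem3:
  fixes scl :: "'k::{real_normed_field,euclidean_space} \<Rightarrow> 'a::banach \<Rightarrow> 'a"
    and Y Z :: "'a set"
    and G :: "('a \<Rightarrow> 'a) set"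
  assumes "banach_over scl"
    and "separable_space (euclidean :: 'a topology)"
    and "reflexive_space scl"
    and "closed_subspace scl Y" and "closed_subspace scl Z" and "complementary Y Z"
    and "subgroup G (GL scl UNIV)" and "bounded_operators G"
    and "invariant_under G Y"
    and "\<nexists>W. closed_subspace scl W \<and> invariant_under G W \<and> {0} \<subset> W \<and> W \<subset> Y"
    and "\<nexists>W. closed_subspace scl W \<and> invariant_under G W \<and> Y \<subset> W \<and> W \<subset> UNIV"
    and "\<nexists>W. closed_subspace scl W \<and> invariant_under G W \<and> complementary Y W"
  shows "sot_iso_onto_image scl G Y (diag_block Y Z)
    \<and> sot_iso_onto_image scl G Z (diag_block Z Y)"
proof -
  interpret X: banach_over scl by (rule assms(1))
  have separable: "\<exists>Q::'a set. countable Q \<and> closure Q = UNIV"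
    using assms(2) unfolding separable_space_def by simp
  have G_bl: "bounded_linear T" if "T \<in> G" for T
    using that subgroup.subset[OF assms(7)] X.linear_automorphism_bounded_linear by (auto simp: GL_def)
  obtain M where M: "\<And>T. T \<in> G \<Longrightarrow> onorm T \<le> M"
    using assms(8) unfolding bounded_operators_def bdd_above_def by auto
  have bound: "norm (T x) \<le> \<bar>M\<bar> * norm x" if "T \<in> G" for T x
  proof -
    have "onorm T \<le> \<bar>M\<bar>" using M[OF that] by simp
    then have "onorm T * norm x \<le> \<bar>M\<bar> * norm x" by (rule mult_right_mono) simp
    with onorm[OF G_bl[OF that], of x] show ?thesis by (rule order_trans)
  qed
  have ZY: "complementary Z Y"
    using assms(6) complementary_commute by blast
  have Y: "X.subspace Y" using assms(4) by (simp add: closed_subspace_def)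
  have "sot_iso_onto_image scl G Y (diag_block Y Z)"
  proof -
    interpret U: bounded_group_representation scl G Y "diag_block Y Z" "\<bar>M\<bar>" "onorm (proj_along Y Z)"
      by (rule X.diag_block_representation) (use assms separable bound in auto)
    have "Y \<subseteq> U.continuous_vectors"
    proof
      fix y assume y: "y \<in> Y"
      have "diag_block Y Z T y = T y" if "T \<in> G" for T
      proof -
        have "T y \<in> Y" using assms(9) that y unfolding invariant_under_def by blast
        then have "proj_along Y Z (T y) = T y"
          using assms(5,6) X.real_subspace[OF Y] X.real_subspace[of Z] X.subspace_0[of Z]
          by (intro proj_alongI) (auto simp: closed_subspace_def complementary_def)
        then show ?thesis using y by (simp add: diag_block_def)
      qed
      then have "((\<lambda>T. T y) \<longlongrightarrow> y) U.near_identity"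
        by (intro Lim_transform_eventually[OF U.h_tendsto[OF y]] eventually_mono[OF U.F_carrier])
      then show "y \<in> U.continuous_vectors"
        unfolding U.continuous_vectors_def by blast
    qed
    \<comment> \<open>otherwise the coannihilator would be an invariant complement of \<open>Y\<close>\<close>
    moreover have "U.continuous_vectors \<noteq> Y"
      using assms(12) U.complementary_continuous_vectors U.closed_subspace_coannihilator
        U.coannihilator_invariant by metis
    ultimately have "U.continuous_vectors = UNIV"
      using assms(11) U.closed_subspace_continuous_vectors U.continuous_vectors_invariant by blast
    then show ?thesis by (rule U.sot_iso_onto_image_if_all_continuous)
  qed
  moreover have "sot_iso_onto_image scl G Z (diag_block Z Y)"
  proof -
    interpret Q: bounded_group_representation scl G Z "diag_block Z Y" "\<bar>M\<bar>" "onorm (proj_along Z Y)"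
      by (rule X.diag_block_representation) (use assms ZY separable bound in auto)
    have "Q.coannihilator \<subseteq> Y"
    proof (rule ccontr)
      assume "\<not> Q.coannihilator \<subseteq> Y"
      then obtain x where x: "x \<in> Q.coannihilator" "x \<notin> Y" by blast
      obtain f :: "'a \<Rightarrow>\<^sub>L real" where f: "\<And>y. y \<in> Y \<Longrightarrow> f y = 0" "f x \<noteq> 0"
        by (rule separating_functional[OF X.real_subspace[OF Y] _ x(2)])
          (use assms(4) in \<open>auto simp: closed_subspace_def\<close>)
      have f_mod: "f a = f b" if "a - b \<in> Y" for a b
        using f(1)[OF that] by (simp add: blinfun.diff_right)
      have works: "proj_along Z Y a \<in> Z" "a - proj_along Z Y a \<in> Y" for a
        using proj_along_works[OF _ _ ZY] X.real_subspace assms(4,5) by (auto simp: closed_subspace_def)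
      have "((\<lambda>T. f (T a)) \<longlongrightarrow> f a) Q.near_identity" for a
      proof -
        let ?z = "proj_along Z Y a"
        have "((\<lambda>T. f (diag_block Z Y T ?z)) \<longlongrightarrow> f ?z) Q.near_identity"
          by (intro tendsto_intros Q.h_tendsto works)
        moreover have "f (diag_block Z Y T ?z) = f (T a)" if T: "T \<in> G" for T
        proof -
          have "T (a - ?z) \<in> Y"
            using assms(9) T works(2) unfolding invariant_under_def by blast
          then have "f (T a) = f (T ?z)"
            by (intro f_mod) (simp add: linear_diff[OF bounded_linear.linear[OF G_bl[OF T]]])
          also have "\<dots> = f (proj_along Z Y (T ?z))"
            by (rule f_mod[OF works(2)])
          finally show ?thesis using works(1) by (simp add: diag_block_def)
        qed
        ultimately have "((\<lambda>T. f (T a)) \<longlongrightarrow> f ?z) Q.near_identity"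
          by (rule Lim_transform_eventually[OF _ eventually_mono[OF Q.F_carrier]])
        then show ?thesis using f_mod[OF works(2)[of a]] by simp
      qed
      then have "f \<in> Q.continuous_functionals"
        unfolding Q.continuous_functionals_def by blast
      with x(1) f(2) show False
        unfolding Q.coannihilator_def by blast
    qed
    \<comment> \<open>otherwise the continuous vectors would be an invariant complement of \<open>Y\<close>\<close>
    moreover have "Q.coannihilator \<noteq> Y"
      using assms(12) Q.complementary_continuous_vectors complementary_commute
        Q.closed_subspace_continuous_vectors Q.continuous_vectors_invariant by metis
    moreover have "0 \<in> Q.coannihilator" by (rule Q.zero_in_coannihilator)
    ultimately have zero: "Q.coannihilator = {0}"
      using assms(10) Q.closed_subspace_coannihilator Q.coannihilator_invariant by blast
    have "x \<in> Q.continuous_vectors" for x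
      using Q.vector_decomposition[of x] unfolding zero by force
    then have "Q.continuous_vectors = UNIV" by blast
    then show ?thesis by (rule Q.sot_iso_onto_image_if_all_continuous)
  qed
  ultimately show ?thesis ..
qed

end
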